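(* Let $(\Omega,\mu)$ be a probability space and let $X$ be a Banach space. Assume that the dual space $X^{*}$ is Gâteaux differentiable. Then, for every $1<p<+\infty$, the dual space $L^{p}(\Omega,X)^{*}$ of $L^{p}(\Omega,X)$ is Gâteaux differentiable.
   Context: A Banach space $(Y,\|\cdot\|)$ is said to be Gâteaux differentiable if for every $a\in Y$, $a\neq 0$, and every $h\in Y$, the limit $$\lim_{\mathbb{R}\ni t\to 0}\frac{\|a+th\|-\|a\|}{t}$$ exists. $L^{p}(\Omega,X)$ denotes the usual Lebesgue–Bochner space of (classes of) strongly measurable functions $f:\Omega\to X$ with $\int_{\Omega}\|f(\omega)\|_X^{p}\,d\mu(\omega)<+\infty$, with norm $\|f\|=\left(\int_{\Omega}\|f(\omega)\|_X^{p}\,d\mu(\omega)\right)^{1/p}$. Dual spaces carry their dual norms. *)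

theory Defs
  imports "HOL-Probability.Probability" "HOL-Library.Function_Algebras"
begin

(* Function_Algebras supplies the pointwise additive structure on functions; with pointwise
   scaling they form a real vector space. *)
instantiation "fun" :: (type, real_vector) real_vector
begin

definition scaleR_fun :: "real \<Rightarrow> ('a \<Rightarrow> 'b) \<Rightarrow> 'a \<Rightarrow> 'b"
  where "scaleR_fun c f = (\<lambda>x. c *\<^sub>R f x)"

instance
  by standard (auto simp: scaleR_fun_def fun_eq_iff scaleR_add_right scaleR_add_left)

end

(* The normed space is given by a linear subspace V of a real vector space and a norm N on V,
   so that it applies both to a normed type (V = UNIV, N = norm) and to spaces that
   are not types. *)
definition gateaux_differentiable :: "'v::real_vector set \<Rightarrow> ('v \<Rightarrow> real) \<Rightarrow> bool"
  where "gateaux_differentiable V N \<longleftrightarrow>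
    (\<forall>a\<in>V. a \<noteq> 0 \<longrightarrow> (\<forall>h\<in>V. \<exists>l. ((\<lambda>t::real. (N (a + t *\<^sub>R h) - N a) / t) \<longlongrightarrow> l) (at 0)))"

(* borel_measurable alone would be too weak (and not closed under sums) for non-separable
   range spaces. Convergence is required everywhere, not just almost everywhere; up to
   equality almost everywhere this gives the same functions. *)
definition strongly_measurable :: "'w measure \<Rightarrow> ('w \<Rightarrow> 'a::real_normed_vector) \<Rightarrow> bool"
  where "strongly_measurable M f \<longleftrightarrow>
    (\<exists>s. (\<forall>n::nat. simple_function M (s n)) \<and> (\<forall>x\<in>space M. (\<lambda>n. s n x) \<longlonglongrightarrow> f x))"

definition Lp_fun :: "'w measure \<Rightarrow> real \<Rightarrow> ('w \<Rightarrow> 'a::real_normed_vector) set"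
  where "Lp_fun M p =
    {f. strongly_measurable M f \<and> (\<integral>\<^sup>+x. ennreal (norm (f x) powr p) \<partial>M) < \<infinity>}"

definition Lp_norm :: "'w measure \<Rightarrow> real \<Rightarrow> ('w \<Rightarrow> 'a::real_normed_vector) \<Rightarrow> real"
  where "Lp_norm M p f = (\<integral>x. norm (f x) powr p \<partial>M) powr (1 / p)"

definition Lp_class ::
    "'w measure \<Rightarrow> real \<Rightarrow> ('w \<Rightarrow> 'a::real_normed_vector) \<Rightarrow> ('w \<Rightarrow> 'a) set"
  where "Lp_class M p f = {g \<in> Lp_fun M p. AE x in M. g x = f x}"

definition Lp_space :: "'w measure \<Rightarrow> real \<Rightarrow> ('w \<Rightarrow> 'a::real_normed_vector) set set"
  where "Lp_space M p = Lp_class M p ` Lp_fun M p"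

(* Bounded linear functionals on the space of classes. They are normalised to 0 outside
   Lp_space, so that equality of functions is equality of functionals. *)
definition Lp_dual ::
    "'w measure \<Rightarrow> real \<Rightarrow> (('w \<Rightarrow> 'a::real_normed_vector) set \<Rightarrow> real) set"
  where "Lp_dual M p = {\<phi>.
    (\<forall>F. F \<notin> Lp_space M p \<longrightarrow> \<phi> F = 0) \<and>
    (\<forall>f\<in>Lp_fun M p. \<forall>g\<in>Lp_fun M p.
      \<phi> (Lp_class M p (f + g)) = \<phi> (Lp_class M p f) + \<phi> (Lp_class M p g)) \<and>
    (\<forall>c. \<forall>f\<in>Lp_fun M p. \<phi> (Lp_class M p (c *\<^sub>R f)) = c * \<phi> (Lp_class M p f)) \<and>
    (\<exists>C. \<forall>f\<in>Lp_fun M p. \<bar>\<phi> (Lp_class M p f)\<bar> \<le> C * Lp_norm M p f)}"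

definition Lp_dual_norm ::
    "'w measure \<Rightarrow> real \<Rightarrow> (('w \<Rightarrow> 'a::real_normed_vector) set \<Rightarrow> real) \<Rightarrow> real"
  where "Lp_dual_norm M p \<phi> =
    (SUP f\<in>{f \<in> Lp_fun M p. Lp_norm M p f \<le> 1}. \<bar>\<phi> (Lp_class M p f)\<bar>)"

end

theory Submission
  imports Defs
begin

text \<open>
Let \<open>1/p + 1/q = 1\<close>. If every functional \<open>\<phi>\<close> on \<open>L\<^sup>p(\<Omega>, X)\<close> came from a field \<open>a(\<omega>)\<close> of functionals
on \<open>X\<close>, one would have
\<open>\<parallel>\<phi> + t \<psi>\<parallel>\<^sup>q = \<integral> \<parallel>a(\<omega>) + t b(\<omega>)\<parallel>\<^sup>q d\<mu>\<close>, and could differentiate under the integral sign, since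
\<open>t \<mapsto> \<parallel>a(\<omega>) + t b(\<omega>)\<parallel>\<^sup>q\<close> is convex and differentiable at \<open>0\<close> by the smoothness of \<open>X\<^sup>*\<close> (and by
\<open>q > 1\<close> where \<open>a(\<omega>) = 0\<close>). For general \<open>X\<close> a strongly measurable field \<open>a\<close> need not exist, but it is
enough to represent \<open>\<phi>\<close> on a countable part of \<open>X\<close>.

The norm \<open>F(t) = \<parallel>\<phi> + t \<psi>\<parallel>\<close> is convex, so it is differentiable at \<open>0\<close> as soon as
\<open>(F(t) + F(-t) - 2 F(0)) / t\<close> tends to \<open>0\<close> along \<open>t = 1/n\<close>. Only countably many values \<open>F(t)\<close> are
involved, and simple functions are dense, so all of them are computed by countably many simple functions, whose
values lie in a countable rational subspace \<open>D\<close> of \<open>X\<close>. For each \<open>x\<close> the set function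
\<open>A \<mapsto> \<phi>(1\<^sub>A x)\<close> has a density \<open>a x\<close> by the Radon-Nikodym theorem
(\<open>density_family_exists\<close>), and for almost every \<open>\<omega>\<close> the map \<open>x \<mapsto> a x \<omega>\<close> is rational-linear
on \<open>D\<close>.

Norms are handled through conjugate functions: \<open>C\<^sup>q / q\<close> is the supremum of
\<open>\<phi>(f) - \<parallel>f\<parallel>\<^sup>p / p\<close> if \<open>C = \<parallel>\<phi>\<parallel>\<close>. As both terms are integrals, this supremum may be taken
pointwise: with \<open>V t \<omega>\<close> the supremum over \<open>x \<in> D\<close> of
\<open>a x \<omega> + t * b x \<omega> - \<parallel>x\<parallel>\<^sup>p / p\<close>, one has \<open>\<integral> V t d\<mu> \<le> F(t)\<^sup>q / q\<close>
(\<open>conjugate_integrand_exists\<close>), and equality for the countably many relevant \<open>t\<close>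
(\<open>simple_function_conjugate_le\<close>). For fixed \<open>\<omega>\<close> the Hahn-Banach theorem extends \<open>a\<close> and \<open>b\<close> from
\<open>D\<close> to functionals \<open>A\<close> and \<open>B\<close> on \<open>X\<close> with \<open>\<parallel>A\<parallel>\<^sup>q / q = V 0 \<omega>\<close>; then
\<open>V t \<omega> \<le> \<parallel>A + t B\<parallel>\<^sup>q / q\<close> with equality at \<open>t = 0\<close>, and smoothness of \<open>X\<^sup>*\<close> controls the second
differences of \<open>V\<close> (\<open>conjugate_second_difference\<close>). Dominated convergence, with the case \<open>t = 1\<close> as
dominating function thanks to convexity, gives the second differences of \<open>F\<^sup>q\<close>, hence those of \<open>F\<close>.
\<close>

section \<open>The Hahn-Banach theorem over a rational subspace\<close>

definition sublinear :: "('a::real_vector \<Rightarrow> real) \<Rightarrow> bool" where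
  "sublinear P \<longleftrightarrow> (\<forall>x y. P (x + y) \<le> P x + P y) \<and> (\<forall>t x. 0 < t \<longrightarrow> P (t *\<^sub>R x) = t * P x)"

lemma sublinear_zero:
  assumes "sublinear P" shows "P 0 = 0"
proof -
  have "P (2 *\<^sub>R 0) = 2 * P 0"
    using assms unfolding sublinear_def by (metis zero_less_numeral)
  then show ?thesis by simp
qed

lemma sublinearI:
  assumes add: "\<And>x y. P (x + y) \<le> P x + P y"
    and scale: "\<And>t x. 0 < t \<Longrightarrow> P (t *\<^sub>R x) \<le> t * P x"
  shows "sublinear P"
  unfolding sublinear_def
proof (intro conjI allI impI)
  fix t :: real and x assume t: "0 < t"
  have "P ((1 / t) *\<^sub>R (t *\<^sub>R x)) \<le> (1 / t) * P (t *\<^sub>R x)"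
    using t by (intro scale) simp
  then have "t * P x \<le> P (t *\<^sub>R x)"
    using t by (simp add: field_simps)
  with scale[OF t] show "P (t *\<^sub>R x) = t * P x" by (simp add: antisym)
qed (rule add)

lemma sublinear_lower:
  assumes "sublinear P" shows "- P (- x) \<le> P x"
proof -
  have "P (x + - x) \<le> P x + P (- x)"
    using assms unfolding sublinear_def by blast
  then show ?thesis using sublinear_zero[OF assms] by simp
qed

text \<open>
Zorn's lemma applies because the pointwise infimum of a chain of sublinear functionals below \<open>P\<close> is
sublinear; it is finite since each of them is at least \<open>- P (- x)\<close> at \<open>x\<close>.
\<close>

lemma minimal_sublinear_exists:
  assumes "sublinear P"
  obtains Q where "sublinear Q" "Q \<le> P" "\<And>R. sublinear R \<Longrightarrow> R \<le> Q \<Longrightarrow> R = Q"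
proof -
  define A where "A = {Q. sublinear Q \<and> Q \<le> P}"
  have po: "partial_order_on A (relation_of (\<ge>) A)"
    by (auto simp: partial_order_on_def preorder_on_def refl_on_def relation_of_def
        intro!: transI antisymI)
  have chain: "\<exists>u\<in>A. \<forall>Q\<in>C. Q \<ge> u" if C: "C \<in> Chains (relation_of (\<ge>) A)" for C
  proof (cases "C = {}")
    case True
    then show ?thesis using assms by (auto simp: A_def)
  next
    case False
    have CA: "C \<subseteq> A" using C by (auto simp: Chains_def relation_of_def)
    have tot: "Q \<le> R \<or> R \<le> Q" if "Q \<in> C" "R \<in> C" for Q R
      using C that by (auto simp: Chains_def relation_of_def)
    define u where "u x = (INF Q\<in>C. Q x)" for x
    have bdd: "bdd_below ((\<lambda>Q. Q x) ` C)" for x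
    proof (rule bdd_belowI2[where m = "- P (- x)"])
      fix Q assume "Q \<in> C"
      then have "sublinear Q" "Q (- x) \<le> P (- x)" using CA by (auto simp: A_def le_fun_def)
      then show "- P (- x) \<le> Q x" using sublinear_lower[of Q x] by linarith
    qed
    have le: "u x \<le> Q x" if "Q \<in> C" for Q x
      unfolding u_def by (rule cINF_lower[OF bdd that])
    have "sublinear u"
    proof (rule sublinearI)
      fix x y
      have "u (x + y) - Q x \<le> R y" if QR: "Q \<in> C" "R \<in> C" for Q R
      proof -
        obtain S where S: "S \<in> C" "S \<le> Q" "S \<le> R" using tot[OF QR] QR by blast
        have "u (x + y) \<le> S (x + y)" by (rule le[OF S(1)])
        also have "\<dots> \<le> S x + S y" using S(1) CA by (auto simp: A_def sublinear_def)
        also have "\<dots> \<le> Q x + R y" using S(2,3) by (intro add_mono) (auto simp: le_fun_def)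
        finally show ?thesis by simp
      qed
      then have "u (x + y) - u y \<le> Q x" if "Q \<in> C" for Q
        using that cINF_greatest[OF False, of "u (x + y) - Q x" "\<lambda>R. R y"] by (force simp: u_def)
      then show "u (x + y) \<le> u x + u y"
        using cINF_greatest[OF False, of "u (x + y) - u y" "\<lambda>Q. Q x"] by (force simp: u_def)
    next
      fix t :: real and x assume t: "0 < t"
      have "u (t *\<^sub>R x) / t \<le> Q x" if "Q \<in> C" for Q
      proof -
        have "Q (t *\<^sub>R x) = t * Q x" using that CA t by (auto simp: A_def sublinear_def)
        then show ?thesis using le[OF that, of "t *\<^sub>R x"] t by (simp add: field_simps)
      qed
      then have "u (t *\<^sub>R x) / t \<le> u x"
        unfolding u_def by (intro cINF_greatest False)
      then show "u (t *\<^sub>R x) \<le> t * u x" using t by (simp add: field_simps)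
    qed
    moreover have "u \<le> P"
    proof (rule le_funI)
      fix x
      obtain Q where "Q \<in> C" using False by blast
      then have "u x \<le> Q x" "Q x \<le> P x" using le CA by (auto simp: A_def le_fun_def)
      then show "u x \<le> P x" by (rule order_trans)
    qed
    ultimately show ?thesis using le by (auto simp: A_def le_fun_def)
  qed
  have "\<exists>Q\<in>A. \<forall>R\<in>A. Q \<ge> R \<longrightarrow> R = Q"
    by (rule predicate_Zorn[OF po chain])
  then obtain Q where Q: "Q \<in> A" "\<And>R. R \<in> A \<Longrightarrow> R \<le> Q \<Longrightarrow> R = Q" by blast
  show thesis
  proof (rule that)
    show "sublinear Q" "Q \<le> P" using Q(1) by (auto simp: A_def)
    show "R = Q" if "sublinear R" "R \<le> Q" for R
      using that Q order_trans[of R Q P] by (auto simp: A_def)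
  qed
qed

text \<open>
The Hahn-Banach theorem: a minimal sublinear functional is linear. Replacing \<open>Q x\<close> by the infimum of
\<open>Q (x + t z) - t Q z\<close> over \<open>t \<ge> 0\<close> gives a sublinear functional below \<open>Q\<close>, hence \<open>Q\<close> itself by
minimality, and the choice \<open>x = - z\<close>, \<open>t = 1\<close> shows that \<open>Q\<close> is odd.
\<close>

lemma sublinear_ge_linear:
  assumes "sublinear P"
  obtains l where "linear l" "\<And>x. l x \<le> P x"
proof -
  obtain Q where Q: "sublinear Q" "Q \<le> P" and min: "\<And>R. sublinear R \<Longrightarrow> R \<le> Q \<Longrightarrow> R = Q"
    using minimal_sublinear_exists[OF assms] by blast
  have add: "Q (x + y) \<le> Q x + Q y" for x y using Q(1) by (auto simp: sublinear_def)
  have scale: "Q (t *\<^sub>R x) = t * Q x" if "0 \<le> t" for t x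
    using Q(1) sublinear_zero[OF Q(1)] that by (cases "t = 0") (auto simp: sublinear_def)
  have odd: "Q (- z) = - Q z" for z
  proof -
    define R where "R x = (INF t\<in>{0..}. Q (x + t *\<^sub>R z) - t * Q z)" for x
    have bdd: "bdd_below ((\<lambda>t. Q (x + t *\<^sub>R z) - t * Q z) ` {0..})" for x
    proof (rule bdd_belowI2[where m = "- Q (- x)"])
      fix t :: real assume "t \<in> {0..}"
      then show "- Q (- x) \<le> Q (x + t *\<^sub>R z) - t * Q z"
        using add[of "x + t *\<^sub>R z" "- x"] scale[of t z] by simp
    qed
    have le: "R x \<le> Q (x + t *\<^sub>R z) - t * Q z" if "0 \<le> t" for t x
      unfolding R_def using that by (intro cINF_lower bdd) auto
    have "sublinear R"
    proof (rule sublinearI)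
      fix x y
      have *: "R (x + y) - (Q (x + s *\<^sub>R z) - s * Q z) \<le> Q (y + t *\<^sub>R z) - t * Q z"
        if "0 \<le> s" "0 \<le> t" for s t
        using le[of "s + t" "x + y"] add[of "x + s *\<^sub>R z" "y + t *\<^sub>R z"] that
        by (simp add: algebra_simps)
      have "R (x + y) - (Q (x + s *\<^sub>R z) - s * Q z) \<le> R y" if "0 \<le> s" for s
        unfolding R_def[of y] using *[OF that] by (intro cINF_greatest) auto
      then have "R (x + y) - R y \<le> R x"
        unfolding R_def[of x] by (intro cINF_greatest) (auto simp: algebra_simps)
      then show "R (x + y) \<le> R x + R y" by simp
    next
      fix s :: real and x assume s: "0 < s"
      have "R (s *\<^sub>R x) / s \<le> Q (x + t *\<^sub>R z) - t * Q z" if "0 \<le> t" for t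
        using le[of "s * t" "s *\<^sub>R x"] scale[of s "x + t *\<^sub>R z"] s that
        by (simp add: field_simps scaleR_add_right)
      then have "R (s *\<^sub>R x) / s \<le> R x"
        unfolding R_def[of x] by (intro cINF_greatest) auto
      then show "R (s *\<^sub>R x) \<le> s * R x" using s by (simp add: field_simps)
    qed
    moreover have "R \<le> Q" using le[of 0] by (auto simp: le_fun_def)
    ultimately have "R = Q" by (rule min)
    then have "Q (- z) \<le> - Q z"
      using le[of 1 "- z"] sublinear_zero[OF Q(1)] by simp
    then show ?thesis using sublinear_lower[OF Q(1), of z] by simp
  qed
  have "linear Q"
  proof (rule linearI)
    show "Q (x + y) = Q x + Q y" for x y
      using add[of x y] add[of "x + y" "- y"] odd[of y] by simp
    show "Q (t *\<^sub>R x) = t *\<^sub>R Q x" for t x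
      using scale[of t x] scale[of "- t" x] odd[of "t *\<^sub>R x"] by (cases "0 \<le> t") auto
  qed
  then show thesis using Q(2) by (intro that) (auto simp: le_fun_def)
qed

text \<open>
Statements about all elements of \<open>D\<close> hold almost everywhere at once if \<open>D\<close> is countable, which no nonzero
real subspace is; hence the restriction to rational scalars.
\<close>

definition rational_subspace :: "'a::real_vector set \<Rightarrow> bool" where
  "rational_subspace D \<longleftrightarrow>
    0 \<in> D \<and> (\<forall>x\<in>D. \<forall>y\<in>D. x + y \<in> D) \<and> (\<forall>r\<in>\<rat>. \<forall>x\<in>D. r *\<^sub>R x \<in> D)"

definition rational_linear_on :: "'a::real_vector set \<Rightarrow> ('a \<Rightarrow> real) \<Rightarrow> bool" where
  "rational_linear_on D a \<longleftrightarrow>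
    (\<forall>x\<in>D. \<forall>y\<in>D. a (x + y) = a x + a y) \<and> (\<forall>r\<in>\<rat>. \<forall>x\<in>D. a (r *\<^sub>R x) = r * a x)"

lemma rational_linear_on_add:
  assumes "rational_linear_on D a" "rational_linear_on D b"
  shows "rational_linear_on D (\<lambda>x. a x + b x)"
  using assms by (simp add: rational_linear_on_def algebra_simps)

text \<open>
The rational span of \<open>S\<close> is the image of the countable set of finite lists of pairs of a rational number and
an element of \<open>S\<close>.
\<close>

lemma countable_rational_subspace_exists:
  fixes S :: "'a::real_vector set"
  assumes "countable S"
  obtains D where "countable D" "S \<subseteq> D" "rational_subspace D"
proof -
  define span where "span xs = (\<Sum>(r, x)\<leftarrow>xs. r *\<^sub>R x)" for xs :: "(real \<times> 'a) list"
  define D where "D = span ` lists (\<rat> \<times> S)"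
  have span_simps: "span [] = 0" "span (rx # xs) = fst rx *\<^sub>R snd rx + span xs"
    "span (xs @ ys) = span xs + span ys" for rx xs ys
    by (simp_all add: span_def case_prod_beta)
  have span_scale: "span (map (\<lambda>(s, x). (r * s, x)) xs) = r *\<^sub>R span xs" for r xs
    by (induction xs) (auto simp: span_simps scaleR_add_right)
  have D_add: "x + y \<in> D" if xy: "x \<in> D" "y \<in> D" for x y
  proof -
    obtain xs ys where "xs \<in> lists (\<rat> \<times> S)" "ys \<in> lists (\<rat> \<times> S)" "x = span xs" "y = span ys"
      using xy unfolding D_def by blast
    then show ?thesis unfolding D_def by (intro image_eqI[of _ _ "xs @ ys"]) (auto simp: span_simps)
  qed
  have D_scale: "r *\<^sub>R x \<in> D" if r: "r \<in> \<rat>" "x \<in> D" for r x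
  proof -
    obtain xs where xs: "xs \<in> lists (\<rat> \<times> S)" "x = span xs" using r unfolding D_def by blast
    have "map (\<lambda>(s, x). (r * s, x)) xs \<in> lists (\<rat> \<times> S)"
      using xs(1) r(1) by (fastforce simp: in_lists_conv_set)
    then show ?thesis unfolding D_def using span_scale[of r xs] xs(2) by (intro image_eqI) auto
  qed
  show thesis
  proof (rule that)
    show "countable D"
      unfolding D_def using assms countable_rat by (intro countable_image countable_lists countable_SIGMA) auto
    show "S \<subseteq> D"
    proof
      fix x assume "x \<in> S"
      then show "x \<in> D" unfolding D_def by (intro image_eqI[of _ _ "[(1, x)]"]) (auto simp: span_simps)
    qed
    have "0 \<in> D" unfolding D_def by (rule image_eqI[of _ _ "[]"]) (auto simp: span_simps)
    then show "rational_subspace D" using D_add D_scale unfolding rational_subspace_def by blast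
  qed
qed

text \<open>
Apply Hahn-Banach to the infimum over \<open>y \<in> D\<close> of \<open>c \<parallel>x - y\<parallel> + a y\<close>, the largest
subadditive function below both \<open>c \<parallel>x\<parallel>\<close> and, on \<open>D\<close>, \<open>a\<close>. Its homogeneity for real factors follows from that for
rational ones by approximation.
\<close>

lemma extend_rational_linear:
  fixes a :: "'a::real_normed_vector \<Rightarrow> real"
  assumes D: "rational_subspace D" and a: "rational_linear_on D a"
    and bound: "\<And>x. x \<in> D \<Longrightarrow> a x \<le> c * norm x" and c: "0 \<le> c"
  obtains l :: "'a \<Rightarrow>\<^sub>L real" where "\<And>x. x \<in> D \<Longrightarrow> l x = a x" "norm l \<le> c"
proof -
  have D0: "0 \<in> D" and Dadd: "\<And>x y. x \<in> D \<Longrightarrow> y \<in> D \<Longrightarrow> x + y \<in> D"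
    and Dscale: "\<And>r x. r \<in> \<rat> \<Longrightarrow> x \<in> D \<Longrightarrow> r *\<^sub>R x \<in> D"
    using D by (auto simp: rational_subspace_def)
  have add: "\<And>x y. x \<in> D \<Longrightarrow> y \<in> D \<Longrightarrow> a (x + y) = a x + a y"
    and scale: "\<And>r x. r \<in> \<rat> \<Longrightarrow> x \<in> D \<Longrightarrow> a (r *\<^sub>R x) = r * a x"
    using a by (auto simp: rational_linear_on_def)
  have a0: "a 0 = 0" using add[of 0 0] D0 by simp
  have neg: "- x \<in> D" "a (- x) = - a x" if "x \<in> D" for x
    using Dscale[of "-1" x] scale[of "-1" x] that by auto
  define P where "P x = (INF y\<in>D. c * norm (x - y) + a y)" for x
  have bdd: "bdd_below ((\<lambda>y. c * norm (x - y) + a y) ` D)" for x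
  proof (rule bdd_belowI2[where m = "- (c * norm x)"])
    fix y assume y: "y \<in> D"
    have "c * norm y \<le> c * (norm (x - y) + norm x)"
      using c norm_triangle_ineq4[of x "x - y"] by (intro mult_left_mono) auto
    then show "- (c * norm x) \<le> c * norm (x - y) + a y"
      using bound[OF neg(1)[OF y]] neg(2)[OF y] by (simp add: algebra_simps)
  qed
  have le: "P x \<le> c * norm (x - y) + a y" if "y \<in> D" for x y
    unfolding P_def using that by (intro cINF_lower bdd) auto
  have ne: "D \<noteq> {}" using D0 by auto
  have "sublinear P"
  proof (rule sublinearI)
    fix x y
    have *: "P (x + y) - (c * norm (x - u) + a u) \<le> c * norm (y - v) + a v" if "u \<in> D" "v \<in> D" for u v
    proof -
      have "c * norm (x + y - (u + v)) \<le> c * (norm (x - u) + norm (y - v))"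
        using c norm_triangle_ineq[of "x - u" "y - v"]
        by (intro mult_left_mono) (auto simp: algebra_simps)
      then show ?thesis
        using le[OF Dadd[OF that], of "x + y"] add[OF that] by (simp add: algebra_simps)
    qed
    have "P (x + y) - (c * norm (x - u) + a u) \<le> P y" if "u \<in> D" for u
      unfolding P_def[of y] using *[OF that] by (intro cINF_greatest ne) auto
    then have "P (x + y) - P y \<le> P x"
      unfolding P_def[of x] by (intro cINF_greatest ne) (auto simp: algebra_simps)
    then show "P (x + y) \<le> P x + P y" by simp
  next
    fix t :: real and x assume t: "0 < t"
    have "P (t *\<^sub>R x) / t \<le> c * norm (x - y) + a y" if y: "y \<in> D" for y
    proof -
      obtain r where r: "\<And>n. r n \<in> \<rat>" "r \<longlonglongrightarrow> t"
        using closure_sequential[of t "\<rat>"] Rats_closure_real by auto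
      have "P (t *\<^sub>R x) \<le> c * norm (t *\<^sub>R x - r n *\<^sub>R y) + r n * a y" for n
        using le[OF Dscale[OF r(1) y], of "t *\<^sub>R x" n] scale[OF r(1) y, of n] by simp
      moreover have "(\<lambda>n. c * norm (t *\<^sub>R x - r n *\<^sub>R y) + r n * a y)
          \<longlonglongrightarrow> c * norm (t *\<^sub>R x - t *\<^sub>R y) + t * a y"
        by (intro tendsto_intros r(2))
      ultimately have "P (t *\<^sub>R x) \<le> c * norm (t *\<^sub>R x - t *\<^sub>R y) + t * a y"
        by (intro LIMSEQ_le_const) auto
      also have "c * norm (t *\<^sub>R x - t *\<^sub>R y) = t * (c * norm (x - y))"
        using t by (simp flip: scaleR_diff_right)
      finally show ?thesis using t by (simp add: field_simps)
    qed
    then have "P (t *\<^sub>R x) / t \<le> P x"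
      unfolding P_def[of x] by (intro cINF_greatest ne)
    then show "P (t *\<^sub>R x) \<le> t * P x" using t by (simp add: field_simps)
  qed
  then obtain l where l: "linear l" "\<And>x. l x \<le> P x" using sublinear_ge_linear by blast
  have upper: "l x \<le> c * norm x" for x using l(2)[of x] le[OF D0, of x] a0 by simp
  have nb: "norm (l x) \<le> norm x * c" for x
    using upper[of x] upper[of "- x"] linear_neg[OF l(1), of x] by (simp add: abs_le_iff mult.commute)
  have bl: "bounded_linear l"
    by (rule bounded_linear_intro[where K = c]) (auto simp: linear_add[OF l(1)] linear_scale[OF l(1)] nb[unfolded real_norm_def])
  show thesis
  proof (rule that[of "Blinfun l"])
    show "blinfun_apply (Blinfun l) x = a x" if "x \<in> D" for x
    proof -
      have "l x \<le> a x" "l (- x) \<le> a (- x)"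
        using l(2)[of x] le[OF that, of x] l(2)[of "- x"] le[OF neg(1)[OF that], of "- x"] by auto
      then show ?thesis using neg(2)[OF that] linear_neg[OF l(1), of x]
        by (simp add: bounded_linear_Blinfun_apply[OF bl])
    qed
    show "norm (Blinfun l) \<le> c"
      using nb c by (intro norm_blinfun_bound) (auto simp: bounded_linear_Blinfun_apply[OF bl] mult.commute)
  qed
qed

section \<open>Densities of signed set functions\<close>

context finite_measure
begin

lemma measure_decseq_empty:
  assumes "range A \<subseteq> sets M" "decseq A" "(\<Inter>i. A i) = {}"
  shows "(\<lambda>i. measure M (A i)) \<longlonglongrightarrow> 0"
  using finite_Lim_measure_decseq[OF assms(1,2)] assms(3) by simp

text \<open>
The bound by a power of the measure gives both continuity at the empty set, hence countable additivity, and
absolute continuity, so that the Radon-Nikodym theorem applies.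
\<close>

lemma positive_density_exists:
  fixes \<sigma> :: "'a set \<Rightarrow> real"
  assumes nonneg: "\<And>A. A \<in> sets M \<Longrightarrow> 0 \<le> \<sigma> A"
    and add: "\<And>A B. A \<in> sets M \<Longrightarrow> B \<in> sets M \<Longrightarrow> A \<inter> B = {} \<Longrightarrow> \<sigma> (A \<union> B) = \<sigma> A + \<sigma> B"
    and bound: "\<And>A. A \<in> sets M \<Longrightarrow> \<sigma> A \<le> C * measure M A powr r" and r: "0 < r"
  obtains f :: "'a \<Rightarrow> real" where "integrable M f" "\<And>A. A \<in> sets M \<Longrightarrow> (LINT x:A|M. f x) = \<sigma> A"
proof -
  have empty: "\<sigma> {} = 0" using add[of "{}" "{}"] by simp
  define \<nu> where "\<nu> A = ennreal (\<sigma> A)" for A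
  have pos: "positive (sets M) \<nu>" by (simp add: positive_def \<nu>_def empty)
  have additive: "additive (sets M) \<nu>"
    unfolding additive_def \<nu>_def using add nonneg by (auto simp: ennreal_plus)
  have "countably_additive (sets M) \<nu>"
  proof (rule sets.empty_continuous_imp_countably_additive[OF pos additive])
    show "\<forall>A\<in>sets M. \<nu> A \<noteq> \<infinity>" by (simp add: \<nu>_def)
    fix A :: "nat \<Rightarrow> 'a set"
    assume A: "range A \<subseteq> sets M" "decseq A" "(\<Inter>i. A i) = {}"
    have "(\<lambda>i. C * measure M (A i) powr r) \<longlonglongrightarrow> C * 0"
      by (intro tendsto_mult tendsto_const tendsto_zero_powrI[OF measure_decseq_empty[OF A]]
          tendsto_const) (use r in auto)
    then have lim: "(\<lambda>i. C * measure M (A i) powr r) \<longlonglongrightarrow> 0" by simp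
    have "(\<lambda>i. \<sigma> (A i)) \<longlonglongrightarrow> 0"
      by (rule tendsto_sandwich[OF _ _ tendsto_const lim])
        (use A(1) nonneg bound in \<open>auto simp: range_subsetD\<close>)
    then show "(\<lambda>i. \<nu> (A i)) \<longlonglongrightarrow> 0"
      unfolding \<nu>_def using tendsto_ennrealI by fastforce
  qed
  then have em: "emeasure (measure_of (space M) (sets M) \<nu>) A = \<nu> A" if "A \<in> sets M" for A
    using that pos by (simp add: emeasure_measure_of_sigma sets.sigma_algebra_axioms)
  have "absolutely_continuous M (measure_of (space M) (sets M) \<nu>)"
  proof (unfold absolutely_continuous_def, rule subsetI)
    fix A assume "A \<in> null_sets M"
    then have A: "A \<in> sets M" "measure M A = 0" by (auto simp: null_sets_def measure_def)
    then have "\<sigma> A = 0" using bound[of A] nonneg[of A] r by simp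
    then show "A \<in> null_sets (measure_of (space M) (sets M) \<nu>)"
      using A em[of A] by (intro null_setsI) (auto simp: \<nu>_def)
  qed
  then obtain g where g: "g \<in> borel_measurable M" "density M g = measure_of (space M) (sets M) \<nu>"
    using Radon_Nikodym by force
  have gA: "(\<integral>\<^sup>+x. g x * indicator A x \<partial>M) = \<nu> A" if "A \<in> sets M" for A
    using em[OF that] emeasure_density[OF g(1) that] g(2) by simp
  have fin: "(\<integral>\<^sup>+x. g x \<partial>M) < \<infinity>"
    using gA[of "space M"] by (simp add: \<nu>_def cong: nn_integral_cong_simp)
  then have ae: "AE x in M. g x < \<infinity>"
    using g(1) nn_integral_PInf_AE by (auto simp: less_top)
  have ge: "AE x in M. ennreal (enn2real (g x)) = g x"
    using ae by eventually_elim (simp add: less_top)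
  show thesis
  proof (rule that[of "\<lambda>x. enn2real (g x)"])
    show "integrable M (\<lambda>x. enn2real (g x))"
    proof (rule integrableI_nonneg)
      have "(\<integral>\<^sup>+x. ennreal (enn2real (g x)) \<partial>M) = (\<integral>\<^sup>+x. g x \<partial>M)"
        by (rule nn_integral_cong_AE[OF ge])
      then show "(\<integral>\<^sup>+x. ennreal (enn2real (g x)) \<partial>M) < \<infinity>" using fin by simp
    qed (use g(1) in auto)
    fix A assume A: "A \<in> sets M"
    have "(LINT x:A|M. enn2real (g x)) = enn2real (\<integral>\<^sup>+x. ennreal (indicator A x *\<^sub>R enn2real (g x)) \<partial>M)"
      unfolding set_lebesgue_integral_def using A g(1) by (intro integral_eq_nn_integral) auto
    also have "(\<integral>\<^sup>+x. ennreal (indicator A x *\<^sub>R enn2real (g x)) \<partial>M) = (\<integral>\<^sup>+x. g x * indicator A x \<partial>M)"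
      using ge by (intro nn_integral_cong_AE) (auto split: split_indicator)
    also have "\<dots> = \<nu> A" by (rule gA[OF A])
    finally show "(LINT x:A|M. enn2real (g x)) = \<sigma> A"
      using nonneg[OF A] by (simp add: \<nu>_def)
  qed
qed

text \<open>
The Jordan decomposition: the upper variation \<open>P A\<close>, the supremum of \<open>\<sigma>\<close> over the measurable subsets of
\<open>A\<close>, is additive and inherits the bound; \<open>P - \<sigma>\<close> is nonnegative and satisfies it with twice the constant.
\<close>

lemma signed_density_exists:
  fixes \<sigma> :: "'a set \<Rightarrow> real"
  assumes add: "\<And>A B. A \<in> sets M \<Longrightarrow> B \<in> sets M \<Longrightarrow> A \<inter> B = {} \<Longrightarrow> \<sigma> (A \<union> B) = \<sigma> A + \<sigma> B"
    and bound: "\<And>A. A \<in> sets M \<Longrightarrow> \<bar>\<sigma> A\<bar> \<le> C * measure M A powr r" and r: "0 < r" and C: "0 \<le> C"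
  obtains f :: "'a \<Rightarrow> real" where "integrable M f" "\<And>A. A \<in> sets M \<Longrightarrow> (LINT x:A|M. f x) = \<sigma> A"
proof -
  have empty: "\<sigma> {} = 0" using add[of "{}" "{}"] by simp
  define P where "P A = (SUP B\<in>{B \<in> sets M. B \<subseteq> A}. \<sigma> B)" for A
  have B_bound: "\<sigma> B \<le> C * measure M A powr r" if "A \<in> sets M" "B \<in> sets M" "B \<subseteq> A" for A B
  proof -
    have "C * measure M B powr r \<le> C * measure M A powr r"
      using that C r by (intro mult_left_mono powr_mono2 finite_measure_mono) auto
    then show ?thesis using bound[OF that(2)] by linarith
  qed
  have bdd: "bdd_above (\<sigma> ` {B \<in> sets M. B \<subseteq> A})" if "A \<in> sets M" for A
    using B_bound[OF that] by (intro bdd_aboveI2) auto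
  have upper: "\<sigma> B \<le> P A" if "A \<in> sets M" "B \<in> sets M" "B \<subseteq> A" for A B
    unfolding P_def using that by (intro cSUP_upper bdd) auto
  have least: "P A \<le> c" if "\<And>B. B \<in> sets M \<Longrightarrow> B \<subseteq> A \<Longrightarrow> \<sigma> B \<le> c" for A c
    unfolding P_def using that by (intro cSUP_least) auto
  have P_nonneg: "0 \<le> P A" if "A \<in> sets M" for A
    using upper[OF that, of "{}"] empty by simp
  have P_add: "P (A \<union> B) = P A + P B" if AB: "A \<in> sets M" "B \<in> sets M" "A \<inter> B = {}" for A B
  proof (rule antisym)
    show "P (A \<union> B) \<le> P A + P B"
    proof (rule least)
      fix S assume S: "S \<in> sets M" "S \<subseteq> A \<union> B"
      have "\<sigma> ((S \<inter> A) \<union> (S \<inter> B)) = \<sigma> (S \<inter> A) + \<sigma> (S \<inter> B)"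
        using S AB by (intro add) auto
      moreover have "(S \<inter> A) \<union> (S \<inter> B) = S" using S by blast
      ultimately show "\<sigma> S \<le> P A + P B"
        using upper[of A "S \<inter> A"] upper[of B "S \<inter> B"] S AB by auto
    qed
    have "P A \<le> P (A \<union> B) - \<sigma> T" if T: "T \<in> sets M" "T \<subseteq> B" for T
    proof (rule least)
      fix S assume S: "S \<in> sets M" "S \<subseteq> A"
      have "\<sigma> (S \<union> T) = \<sigma> S + \<sigma> T" using S T AB by (intro add) auto
      moreover have "\<sigma> (S \<union> T) \<le> P (A \<union> B)" using S T AB by (intro upper) auto
      ultimately show "\<sigma> S \<le> P (A \<union> B) - \<sigma> T" by simp
    qed
    then have "P B \<le> P (A \<union> B) - P A" by (intro least) force
    then show "P A + P B \<le> P (A \<union> B)" by simp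
  qed
  obtain f where f: "integrable M f" "\<And>A. A \<in> sets M \<Longrightarrow> (LINT x:A|M. f x) = P A"
    using positive_density_exists[of P C r] P_nonneg P_add least B_bound r by metis
  have "P A - \<sigma> A \<le> 2 * C * measure M A powr r" if "A \<in> sets M" for A
    using least[of A "C * measure M A powr r"] B_bound[OF that] bound[OF that] by fastforce
  then obtain g where g: "integrable M g" "\<And>A. A \<in> sets M \<Longrightarrow> (LINT x:A|M. g x) = P A - \<sigma> A"
    using positive_density_exists[of "\<lambda>A. P A - \<sigma> A" "2 * C" r] P_add add upper r
    by (smt (verit, ccfv_SIG) order_refl)
  show thesis
  proof (rule that[of "\<lambda>x. f x - g x"])
    fix A assume A: "A \<in> sets M"
    have "set_integrable M A f" "set_integrable M A g"
      unfolding set_integrable_def by (intro integrable_mult_indicator A f(1) g(1))+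
    then show "(LINT x:A|M. f x - g x) = \<sigma> A"
      using f(2)[OF A] g(2)[OF A] by (simp add: set_integral_diff)
  qed (use f g in simp)
qed

end

section \<open>Bochner spaces and their duals\<close>

lemma strongly_measurableE:
  assumes "strongly_measurable M f"
  obtains s where "\<And>n::nat. simple_function M (s n)" "\<And>x. x \<in> space M \<Longrightarrow> (\<lambda>n. s n x) \<longlonglongrightarrow> f x"
  using assms unfolding strongly_measurable_def by blast

lemma simple_function_strongly_measurable:
  "simple_function M f \<Longrightarrow> strongly_measurable M f"
  unfolding strongly_measurable_def by (intro exI[of _ "\<lambda>_. f"]) simp

lemma strongly_measurable_add:
  assumes f: "strongly_measurable M f" and g: "strongly_measurable M g"
  shows "strongly_measurable M (f + g)"
proof -
  obtain s where s: "\<And>n. simple_function M (s n)" "\<And>x. x \<in> space M \<Longrightarrow> (\<lambda>n. s n x) \<longlonglongrightarrow> f x"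
    using strongly_measurableE[OF f] by blast
  obtain t where t: "\<And>n. simple_function M (t n)" "\<And>x. x \<in> space M \<Longrightarrow> (\<lambda>n. t n x) \<longlonglongrightarrow> g x"
    using strongly_measurableE[OF g] by blast
  show ?thesis
    unfolding strongly_measurable_def plus_fun_apply
  proof (intro exI conjI allI ballI)
    show "simple_function M (\<lambda>x. s n x + t n x)" for n
      by (rule simple_function_add[OF s(1) t(1)])
    show "(\<lambda>n. s n x + t n x) \<longlonglongrightarrow> f x + g x" if "x \<in> space M" for x
      by (rule tendsto_add[OF s(2)[OF that] t(2)[OF that]])
  qed
qed

lemma strongly_measurable_scaleR:
  assumes "strongly_measurable M f"
  shows "strongly_measurable M (c *\<^sub>R f)"
proof -
  obtain s where s: "\<And>n. simple_function M (s n)" "\<And>x. x \<in> space M \<Longrightarrow> (\<lambda>n. s n x) \<longlonglongrightarrow> f x"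
    using strongly_measurableE[OF assms] by blast
  show ?thesis
    unfolding strongly_measurable_def scaleR_fun_def
  proof (intro exI conjI allI ballI)
    show "simple_function M (\<lambda>x. c *\<^sub>R s n x)" for n
      by (rule simple_function_compose1[OF s(1)])
    show "(\<lambda>n. c *\<^sub>R s n x) \<longlonglongrightarrow> c *\<^sub>R f x" if "x \<in> space M" for x
      by (rule tendsto_scaleR[OF tendsto_const s(2)[OF that]])
  qed
qed

lemma strongly_measurable_diff:
  assumes "strongly_measurable M f" "strongly_measurable M g"
  shows "strongly_measurable M (f - g)"
  using strongly_measurable_add[OF assms(1) strongly_measurable_scaleR[OF assms(2), of "-1"]] by simp

lemma strongly_measurable_borel:
  assumes "strongly_measurable M f" shows "f \<in> borel_measurable M"
proof -
  obtain s where s: "\<And>n. simple_function M (s n)" "\<And>x. x \<in> space M \<Longrightarrow> (\<lambda>n. s n x) \<longlonglongrightarrow> f x"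
    using strongly_measurableE[OF assms] by blast
  show ?thesis
    by (rule borel_measurable_LIMSEQ_metric[OF borel_measurable_simple_function[OF s(1)] s(2)])
qed

lemma Lp_fun_iff:
  "f \<in> Lp_fun M p \<longleftrightarrow> strongly_measurable M f \<and> integrable M (\<lambda>x. norm (f x) powr p)"
  using strongly_measurable_borel[of M f]
  by (auto simp: Lp_fun_def integrable_iff_bounded borel_measurable_norm)

lemma Lp_fun_scaleR: "f \<in> Lp_fun M p \<Longrightarrow> c *\<^sub>R f \<in> Lp_fun M p"
  using strongly_measurable_scaleR[of M f c]
  by (auto simp: Lp_fun_iff scaleR_fun_def powr_mult)

lemma powr_norm_add_le:
  fixes a b :: "'a::real_normed_vector"
  assumes "0 \<le> p"
  shows "norm (a + b) powr p \<le> 2 powr p * (norm a powr p + norm b powr p)"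
proof -
  have "norm (a + b) powr p \<le> (2 * max (norm a) (norm b)) powr p"
    using assms norm_triangle_ineq[of a b] by (intro powr_mono2) auto
  also have "\<dots> = 2 powr p * max (norm a) (norm b) powr p" by (simp add: powr_mult)
  also have "\<dots> \<le> 2 powr p * (norm a powr p + norm b powr p)"
    by (intro mult_left_mono) (auto simp: max_def)
  finally show ?thesis .
qed

lemma Lp_fun_add:
  assumes "f \<in> Lp_fun M p" "g \<in> Lp_fun M p" "0 \<le> p"
  shows "f + g \<in> Lp_fun M p"
proof -
  have "integrable M (\<lambda>x. norm ((f + g) x) powr p)"
  proof (rule Bochner_Integration.integrable_bound)
    show "integrable M (\<lambda>x. 2 powr p * (norm (f x) powr p + norm (g x) powr p))"
      using assms by (auto simp: Lp_fun_iff)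
    show "(\<lambda>x. norm ((f + g) x) powr p) \<in> borel_measurable M"
    proof -
      have [measurable]: "f + g \<in> borel_measurable M"
        using assms(1,2) by (intro strongly_measurable_borel strongly_measurable_add) (auto simp: Lp_fun_def)
      show ?thesis by measurable
    qed
    show "AE x in M. norm (norm ((f + g) x) powr p)
        \<le> norm (2 powr p * (norm (f x) powr p + norm (g x) powr p))"
      using powr_norm_add_le[OF assms(3)] by (intro AE_I2) simp
  qed
  then show ?thesis using assms by (auto simp: Lp_fun_iff strongly_measurable_add)
qed

lemma (in finite_measure) simple_function_integrable:
  fixes h :: "'b \<Rightarrow> real"
  assumes "simple_function M f" shows "integrable M (\<lambda>x. h (f x))"
proof (rule integrableI_bounded_set[where A = "space M" and B = "Max ((\<lambda>v. \<bar>h v\<bar>) ` f ` space M)"])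
  show "(\<lambda>x. h (f x)) \<in> borel_measurable M"
    by (rule borel_measurable_simple_function[OF simple_function_compose1[OF assms]])
  show "AE x in M. x \<in> space M \<longrightarrow> norm (h (f x)) \<le> Max ((\<lambda>v. \<bar>h v\<bar>) ` f ` space M)"
    using simple_functionD(1)[OF assms] by (auto intro!: Max_ge)
qed (simp_all add: less_top[symmetric])

lemma (in finite_measure) simple_function_Lp:
  assumes "simple_function M f" shows "f \<in> Lp_fun M p"
  using simple_function_strongly_measurable[OF assms] simple_function_integrable[OF assms]
  by (simp add: Lp_fun_iff)

lemma Lp_norm_nonneg: "0 \<le> Lp_norm M p f"
  by (simp add: Lp_norm_def)

lemma Lp_norm_powr:
  assumes "0 < p" shows "Lp_norm M p f powr p = (\<integral>x. norm (f x) powr p \<partial>M)"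
  using assms by (simp add: Lp_norm_def powr_powr powr_one' )

lemma Lp_norm_scaleR:
  assumes "0 < p" shows "Lp_norm M p (c *\<^sub>R f) = \<bar>c\<bar> * Lp_norm M p f"
  using assms by (simp add: Lp_norm_def scaleR_fun_def powr_mult powr_powr)

text \<open>
Pointwise approximation by simple functions becomes dominated after discarding the values whose norm
exceeds \<open>2 \<parallel>f \<omega>\<parallel>\<close>.
\<close>

lemma simple_functions_dense_Lp:
  assumes f: "f \<in> Lp_fun M p" and p: "0 < p"
  obtains s where "\<And>n. simple_function M (s n)"
    "(\<lambda>n. Lp_norm M p (f - s n)) \<longlonglongrightarrow> 0"
    "(\<lambda>n. \<integral>x. norm (s n x) powr p \<partial>M) \<longlonglongrightarrow> (\<integral>x. norm (f x) powr p \<partial>M)"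
proof -
  obtain r where r: "\<And>n. simple_function M (r n)" "\<And>x. x \<in> space M \<Longrightarrow> (\<lambda>n. r n x) \<longlonglongrightarrow> f x"
    using f strongly_measurableE[of M f] unfolding Lp_fun_def by blast
  have [measurable]: "f \<in> borel_measurable M"
    using f by (auto simp: Lp_fun_def strongly_measurable_borel)
  have int: "integrable M (\<lambda>x. norm (f x) powr p)" using f by (simp add: Lp_fun_iff)
  have [measurable]: "r n \<in> borel_measurable M" for n
    using r(1) by (rule borel_measurable_simple_function)
  define A where "A n = {x \<in> space M. norm (r n x) \<le> 2 * norm (f x)}" for n
  have A[measurable]: "A n \<in> sets M" for n unfolding A_def by measurable
  define s where "s n x = (indicator (A n) x :: real) *\<^sub>R r n x" for n x
  have simple: "simple_function M (s n)" for n
    unfolding s_def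
    by (rule simple_function_compose2[where h = "(*\<^sub>R)", OF simple_function_indicator[OF A] r(1)])
  have [measurable]: "s n \<in> borel_measurable M" for n
    using simple by (rule borel_measurable_simple_function)
  have le: "norm (s n x) \<le> 2 * norm (f x)" if "x \<in> space M" for n x
    using that by (auto simp: s_def A_def indicator_def)
  have lim: "(\<lambda>n. s n x) \<longlonglongrightarrow> f x" if x: "x \<in> space M" for x
  proof (cases "f x = 0")
    case True
    then have "s n x = 0" for n using le[OF x, of n] by simp
    then show ?thesis using True by simp
  next
    case False
    then have "norm (f x) < 2 * norm (f x)" by simp
    then have "eventually (\<lambda>n. norm (r n x) < 2 * norm (f x)) sequentially"
      by (rule order_tendstoD(2)[OF tendsto_norm[OF r(2)[OF x]]])
    then have "eventually (\<lambda>n. r n x = s n x) sequentially"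
      by eventually_elim (use x in \<open>auto simp: s_def A_def\<close>)
    then show ?thesis using r(2)[OF x] by (rule Lim_transform_eventually[rotated])
  qed
  have conv: "(\<lambda>n. \<integral>x. norm (s n x) powr p \<partial>M) \<longlonglongrightarrow> (\<integral>x. norm (f x) powr p \<partial>M)"
  proof (rule integral_dominated_convergence[where w = "\<lambda>x. (2 * norm (f x)) powr p"])
    show "integrable M (\<lambda>x. (2 * norm (f x)) powr p)" using int by (simp add: powr_mult)
    show "AE x in M. (\<lambda>n. norm (s n x) powr p) \<longlonglongrightarrow> norm (f x) powr p"
      using lim p by (intro AE_I2 tendsto_powr2 tendsto_norm tendsto_const) auto
    show "AE x in M. norm (norm (s n x) powr p) \<le> (2 * norm (f x)) powr p" for n
      using le p by (intro AE_I2) (auto intro!: powr_mono2)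
  qed simp_all
  have [measurable]: "(\<lambda>x. f x - s n x) \<in> borel_measurable M" for n
    using strongly_measurable_borel[OF strongly_measurable_diff[of M f "s n"]] f
      simple_function_strongly_measurable[OF simple[of n]]
    by (simp add: Lp_fun_def fun_diff_def)
  have "(\<lambda>n. \<integral>x. norm (f x - s n x) powr p \<partial>M) \<longlonglongrightarrow> (\<integral>x. 0 \<partial>M)"
  proof (rule integral_dominated_convergence[where w = "\<lambda>x. (3 * norm (f x)) powr p"])
    show "integrable M (\<lambda>x. (3 * norm (f x)) powr p)" using int by (simp add: powr_mult)
    have "(\<lambda>n. norm (f x - s n x) powr p) \<longlonglongrightarrow> norm (f x - f x) powr p" if "x \<in> space M" for x
      using lim[OF that] p by (intro tendsto_powr2 tendsto_intros) auto
    then show "AE x in M. (\<lambda>n. norm (f x - s n x) powr p) \<longlonglongrightarrow> 0" by (intro AE_I2) simp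
    have "norm (f x - s n x) powr p \<le> (3 * norm (f x)) powr p" if "x \<in> space M" for n x
      using le[OF that, of n] norm_triangle_ineq4[of "f x" "s n x"] p by (intro powr_mono2) auto
    then show "AE x in M. norm (norm (f x - s n x) powr p) \<le> (3 * norm (f x)) powr p" for n
      by (intro AE_I2) auto
  qed simp_all
  then have "(\<lambda>n. (\<integral>x. norm (f x - s n x) powr p \<partial>M) powr (1 / p)) \<longlonglongrightarrow> 0 powr (1 / p)"
    using p by (intro tendsto_powr2 tendsto_const) auto
  then have "(\<lambda>n. Lp_norm M p (f - s n)) \<longlonglongrightarrow> 0"
    by (simp add: Lp_norm_def fun_diff_def)
  from simple this conv show thesis by (rule that)
qed

text \<open>
Bounded linear functionals as they act on representatives. The constant \<open>C\<close> is any bound for the norm, not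
necessarily the least one.
\<close>

definition Lp_functional where
  "Lp_functional M p C L \<longleftrightarrow>
    (\<forall>f\<in>Lp_fun M p. \<forall>g\<in>Lp_fun M p. L (f + g) = L f + L g) \<and>
    (\<forall>c. \<forall>f\<in>Lp_fun M p. L (c *\<^sub>R f) = c * L f) \<and>
    (\<forall>f\<in>Lp_fun M p. \<bar>L f\<bar> \<le> C * Lp_norm M p f)"

lemma Lp_functional_simple_approx:
  assumes fin: "finite_measure M" and L: "Lp_functional M p C L" and p: "0 < p"
    and f: "f \<in> Lp_fun M p" and less: "c < L f - (\<integral>x. norm (f x) powr p \<partial>M) / p"
  obtains s where "simple_function M s" "c < L s - (\<integral>x. norm (s x) powr p \<partial>M) / p"
proof -
  interpret finite_measure M by (rule fin)
  obtain s where s: "\<And>n. simple_function M (s n)" "(\<lambda>n. Lp_norm M p (f - s n)) \<longlonglongrightarrow> 0"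
    "(\<lambda>n. \<integral>x. norm (s n x) powr p \<partial>M) \<longlonglongrightarrow> (\<integral>x. norm (f x) powr p \<partial>M)"
    using simple_functions_dense_Lp[OF f p] by blast
  have sL: "s n \<in> Lp_fun M p" for n using s(1) by (rule simple_function_Lp)
  have "\<bar>L f - L (s n)\<bar> \<le> C * Lp_norm M p (f - s n)" for n
  proof -
    have eq: "f - s n = f + (-1) *\<^sub>R s n" by (simp add: fun_eq_iff scaleR_fun_def)
    have "f - s n \<in> Lp_fun M p" unfolding eq using f sL p by (intro Lp_fun_add Lp_fun_scaleR) auto
    moreover have "L (f - s n) = L f - L (s n)"
    proof -
      have "L (f + (-1) *\<^sub>R s n) = L f + L ((-1) *\<^sub>R s n)"
        using L f Lp_fun_scaleR[OF sL[of n], of "-1"] unfolding Lp_functional_def by blast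
      moreover have "L ((-1) *\<^sub>R s n) = (-1) * L (s n)"
        using L sL[of n] unfolding Lp_functional_def by blast
      ultimately show ?thesis unfolding eq by simp
    qed
    moreover have "\<bar>L (f - s n)\<bar> \<le> C * Lp_norm M p (f - s n)"
      using L \<open>f - s n \<in> Lp_fun M p\<close> unfolding Lp_functional_def by blast
    ultimately show ?thesis by simp
  qed
  then have "(\<lambda>n. L (s n) - L f) \<longlonglongrightarrow> 0"
    using tendsto_mult_right_zero[OF s(2), of C]
    by (intro Lim_null_comparison[of "\<lambda>n. L (s n) - L f" "\<lambda>n. C * Lp_norm M p (f - s n)"])
      (auto simp: abs_minus_commute)
  then have "(\<lambda>n. L (s n)) \<longlonglongrightarrow> L f" by (rule LIM_zero_cancel)
  then have "(\<lambda>n. L (s n) - (\<integral>x. norm (s n x) powr p \<partial>M) / p) \<longlonglongrightarrow> L f - (\<integral>x. norm (f x) powr p \<partial>M) / p"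
    by (intro tendsto_diff tendsto_divide s(3)) (use p in auto)
  then have "eventually (\<lambda>n. c < L (s n) - (\<integral>x. norm (s n x) powr p \<partial>M) / p) sequentially"
    using less by (rule order_tendstoD)
  then obtain n where "c < L (s n) - (\<integral>x. norm (s n x) powr p \<partial>M) / p"
    by (auto simp: eventually_sequentially)
  then show thesis using that s(1) by blast
qed

lemma Lp_dual_norm_upper:
  assumes \<phi>: "\<phi> \<in> Lp_dual M p" and f: "f \<in> Lp_fun M p" "Lp_norm M p f \<le> 1"
  shows "\<bar>\<phi> (Lp_class M p f)\<bar> \<le> Lp_dual_norm M p \<phi>"
proof -
  obtain C where C: "\<And>f. f \<in> Lp_fun M p \<Longrightarrow> \<bar>\<phi> (Lp_class M p f)\<bar> \<le> C * Lp_norm M p f"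
    using \<phi> unfolding Lp_dual_def by blast
  have "bdd_above ((\<lambda>f. \<bar>\<phi> (Lp_class M p f)\<bar>) ` {f \<in> Lp_fun M p. Lp_norm M p f \<le> 1})"
  proof (rule bdd_aboveI2[where M = "\<bar>C\<bar>"])
    fix f :: "'a \<Rightarrow> 'b" assume "f \<in> {f \<in> Lp_fun M p. Lp_norm M p f \<le> 1}"
    then have f: "f \<in> Lp_fun M p" "Lp_norm M p f \<le> 1" by auto
    have "C * Lp_norm M p f \<le> \<bar>C\<bar> * 1"
      using Lp_norm_nonneg[of M p f] f(2) by (intro mult_mono) auto
    then show "\<bar>\<phi> (Lp_class M p f)\<bar> \<le> \<bar>C\<bar>" using C[OF f(1)] by simp
  qed
  then show ?thesis unfolding Lp_dual_norm_def using f by (intro cSUP_upper) auto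
qed

lemma Lp_fun_zero: "(0 :: 'a \<Rightarrow> 'b::real_normed_vector) \<in> Lp_fun M p"
  using simple_function_strongly_measurable[of M "\<lambda>_. 0 :: 'b"] by (simp add: Lp_fun_iff func_zero)

lemma Lp_dual_norm_least:
  assumes "\<And>f. f \<in> Lp_fun M p \<Longrightarrow> Lp_norm M p f \<le> 1 \<Longrightarrow> \<bar>\<phi> (Lp_class M p f)\<bar> \<le> c"
  shows "Lp_dual_norm M p \<phi> \<le> c"
proof -
  have "(0 :: 'a \<Rightarrow> 'b) \<in> {f \<in> Lp_fun M p. Lp_norm M p f \<le> 1}"
    by (auto simp: Lp_fun_zero Lp_norm_def)
  then show ?thesis unfolding Lp_dual_norm_def using assms by (intro cSUP_least) auto
qed

lemma Lp_dual_norm_nonneg: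
  assumes "\<phi> \<in> Lp_dual M p" shows "0 \<le> Lp_dual_norm M p \<phi>"
proof -
  have "\<bar>\<phi> (Lp_class M p 0)\<bar> \<le> Lp_dual_norm M p \<phi>"
    by (rule Lp_dual_norm_upper[OF assms Lp_fun_zero]) (simp add: Lp_norm_def)
  then show ?thesis by linarith
qed

lemma Lp_dual_functional:
  assumes \<phi>: "\<phi> \<in> Lp_dual M p" and p: "0 < p"
  shows "Lp_functional M p (Lp_dual_norm M p \<phi>) (\<lambda>f. \<phi> (Lp_class M p f))"
proof -
  obtain C where C: "\<And>f. f \<in> Lp_fun M p \<Longrightarrow> \<bar>\<phi> (Lp_class M p f)\<bar> \<le> C * Lp_norm M p f"
    using \<phi> unfolding Lp_dual_def by blast
  have scale: "\<And>c f. f \<in> Lp_fun M p \<Longrightarrow> \<phi> (Lp_class M p (c *\<^sub>R f)) = c * \<phi> (Lp_class M p f)"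
    using \<phi> unfolding Lp_dual_def by blast
  have "\<bar>\<phi> (Lp_class M p f)\<bar> \<le> Lp_dual_norm M p \<phi> * Lp_norm M p f" if f: "f \<in> Lp_fun M p" for f
  proof (cases "Lp_norm M p f = 0")
    case True
    then show ?thesis using C[OF f] by simp
  next
    case False
    then have pos: "0 < Lp_norm M p f" using Lp_norm_nonneg[of M p f] by linarith
    have "\<bar>\<phi> (Lp_class M p ((1 / Lp_norm M p f) *\<^sub>R f))\<bar> \<le> Lp_dual_norm M p \<phi>"
      using pos p by (intro Lp_dual_norm_upper[OF \<phi>] Lp_fun_scaleR f) (simp add: Lp_norm_scaleR)
    then show ?thesis using pos unfolding scale[OF f] by (simp add: abs_mult field_simps)
  qed
  then show ?thesis using \<phi> unfolding Lp_functional_def Lp_dual_def by blast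
qed

lemma Lp_dual_norm_pos:
  assumes \<phi>: "\<phi> \<in> Lp_dual M p" "\<phi> \<noteq> 0" and p: "0 < p"
  shows "0 < Lp_dual_norm M p \<phi>"
proof (rule ccontr)
  assume "\<not> ?thesis"
  then have "Lp_dual_norm M p \<phi> = 0" using Lp_dual_norm_nonneg[OF \<phi>(1)] by simp
  then have "\<phi> (Lp_class M p f) = 0" if "f \<in> Lp_fun M p" for f
    using Lp_dual_functional[OF \<phi>(1) p] that unfolding Lp_functional_def by fastforce
  then have "\<phi> F = 0" for F
    using \<phi>(1) unfolding Lp_dual_def Lp_space_def by (cases "F \<in> Lp_space M p") (auto simp: Lp_space_def)
  then show False using \<phi>(2) by (auto simp: fun_eq_iff)
qed

lemma Lp_dual_line:
  assumes \<phi>: "\<phi> \<in> Lp_dual M p" and \<psi>: "\<psi> \<in> Lp_dual M p"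
  shows "\<phi> + t *\<^sub>R \<psi> \<in> Lp_dual M p"
proof -
  obtain C where C: "\<And>f. f \<in> Lp_fun M p \<Longrightarrow> \<bar>\<phi> (Lp_class M p f)\<bar> \<le> C * Lp_norm M p f"
    using \<phi> unfolding Lp_dual_def by blast
  obtain D where D: "\<And>f. f \<in> Lp_fun M p \<Longrightarrow> \<bar>\<psi> (Lp_class M p f)\<bar> \<le> D * Lp_norm M p f"
    using \<psi> unfolding Lp_dual_def by blast
  have "\<bar>(\<phi> + t *\<^sub>R \<psi>) (Lp_class M p f)\<bar> \<le> (C + \<bar>t\<bar> * D) * Lp_norm M p f" if f: "f \<in> Lp_fun M p" for f
  proof -
    have "\<bar>\<phi> (Lp_class M p f) + t * \<psi> (Lp_class M p f)\<bar>
        \<le> \<bar>\<phi> (Lp_class M p f)\<bar> + \<bar>t\<bar> * \<bar>\<psi> (Lp_class M p f)\<bar>"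
      using abs_triangle_ineq[of "\<phi> (Lp_class M p f)"] by (simp flip: abs_mult)
    also have "\<dots> \<le> C * Lp_norm M p f + \<bar>t\<bar> * (D * Lp_norm M p f)"
      by (intro add_mono mult_left_mono C D f) auto
    finally show ?thesis by (simp add: scaleR_fun_def algebra_simps)
  qed
  then have "\<exists>K. \<forall>f\<in>Lp_fun M p. \<bar>(\<phi> + t *\<^sub>R \<psi>) (Lp_class M p f)\<bar> \<le> K * Lp_norm M p f"
    by blast
  moreover have "\<And>F. F \<notin> Lp_space M p \<Longrightarrow> (\<phi> + t *\<^sub>R \<psi>) F = 0"
    using \<phi> \<psi> unfolding Lp_dual_def by (simp add: scaleR_fun_def)
  moreover have "(\<phi> + t *\<^sub>R \<psi>) (Lp_class M p (f + g))
      = (\<phi> + t *\<^sub>R \<psi>) (Lp_class M p f) + (\<phi> + t *\<^sub>R \<psi>) (Lp_class M p g)"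
    if "f \<in> Lp_fun M p" "g \<in> Lp_fun M p" for f g
  proof -
    have "\<phi> (Lp_class M p (f + g)) = \<phi> (Lp_class M p f) + \<phi> (Lp_class M p g)"
      "\<psi> (Lp_class M p (f + g)) = \<psi> (Lp_class M p f) + \<psi> (Lp_class M p g)"
      using \<phi> \<psi> that unfolding Lp_dual_def by blast+
    then show ?thesis by (simp add: scaleR_fun_def algebra_simps)
  qed
  moreover have "(\<phi> + t *\<^sub>R \<psi>) (Lp_class M p (c *\<^sub>R f)) = c * (\<phi> + t *\<^sub>R \<psi>) (Lp_class M p f)"
    if "f \<in> Lp_fun M p" for c f
  proof -
    have "\<phi> (Lp_class M p (c *\<^sub>R f)) = c * \<phi> (Lp_class M p f)"
      "\<psi> (Lp_class M p (c *\<^sub>R f)) = c * \<psi> (Lp_class M p f)"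
      using \<phi> \<psi> that unfolding Lp_dual_def by blast+
    then have "(\<phi> + t *\<^sub>R \<psi>) (Lp_class M p (c *\<^sub>R f))
        = c * \<phi> (Lp_class M p f) + t * (c * \<psi> (Lp_class M p f))"
      by (simp only: plus_fun_apply scaleR_fun_def real_scaleR_def)
    then show ?thesis by (simp add: scaleR_fun_def algebra_simps)
  qed
  ultimately show ?thesis unfolding Lp_dual_def by blast
qed

section \<open>Pointwise densities of a functional and its conjugate\<close>

text \<open>
The function \<open>d x\<close> is the density of the set function \<open>A \<mapsto> L(1\<^sub>A x)\<close>. Thus \<open>x \<mapsto> d x \<omega>\<close> stands in for
the functional that represents \<open>L\<close> at the point \<open>\<omega>\<close>; its linearity holds only up to null sets that depend on the
vectors and scalars involved.
\<close>

definition density_family :: "'w measure \<Rightarrow> (('w \<Rightarrow> 'a::real_normed_vector) \<Rightarrow> real) \<Rightarrow> ('a \<Rightarrow> 'w \<Rightarrow> real) \<Rightarrow> bool"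
  where "density_family M L d \<longleftrightarrow>
    (\<forall>x. integrable M (d x) \<and> (\<forall>A\<in>sets M. (LINT \<omega>:A|M. d x \<omega>) = L (\<lambda>\<omega>. indicator A \<omega> *\<^sub>R x)))"

lemma density_family_integrable: "density_family M L d \<Longrightarrow> integrable M (d x)"
  by (simp add: density_family_def)

lemma density_family_set_integral:
  "density_family M L d \<Longrightarrow> A \<in> sets M \<Longrightarrow> (LINT \<omega>:A|M. d x \<omega>) = L (\<lambda>\<omega>. indicator A \<omega> *\<^sub>R x)"
  by (simp add: density_family_def)

lemma density_family_set_integrable:
  "density_family M L d \<Longrightarrow> A \<in> sets M \<Longrightarrow> set_integrable M A (d x)"
  unfolding set_integrable_def by (rule integrable_mult_indicator[OF _ density_family_integrable])

lemma density_family_line: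
  assumes "density_family M K d" "density_family M L e"
  shows "density_family M (\<lambda>f. K f + t * L f) (\<lambda>x \<omega>. d x \<omega> + t * e x \<omega>)"
  unfolding density_family_def
proof (intro allI conjI ballI)
  fix x
  show "integrable M (\<lambda>\<omega>. d x \<omega> + t * e x \<omega>)"
    using assms by (simp add: density_family_def)
  fix A assume A: "A \<in> sets M"
  note AA = density_family_set_integrable[OF _ A] density_family_set_integral[OF _ A]
  have "(LINT \<omega>:A|M. d x \<omega> + t * e x \<omega>) = (LINT \<omega>:A|M. d x \<omega>) + (LINT \<omega>:A|M. t * e x \<omega>)"
    by (rule set_integral_add(2)[OF AA(1)[OF assms(1)] set_integrable_mult_right[OF AA(1)[OF assms(2)]]])
  also have "\<dots> = K (\<lambda>\<omega>. indicator A \<omega> *\<^sub>R x) + t * L (\<lambda>\<omega>. indicator A \<omega> *\<^sub>R x)"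
    by (simp only: set_integral_mult_right AA(2)[OF assms(1)] AA(2)[OF assms(2)])
  finally show "(LINT \<omega>:A|M. d x \<omega> + t * e x \<omega>)
      = K (\<lambda>\<omega>. indicator A \<omega> *\<^sub>R x) + t * L (\<lambda>\<omega>. indicator A \<omega> *\<^sub>R x)" .
qed

context finite_measure
begin

lemma indicator_scaleR_Lp:
  assumes "A \<in> sets M" shows "(\<lambda>\<omega>. (indicator A \<omega> :: real) *\<^sub>R x) \<in> Lp_fun M p"
  by (rule simple_function_Lp[OF simple_function_compose1[OF simple_function_indicator[OF assms]]])

lemma Lp_functional_add:
  assumes "Lp_functional M p C L" "f \<in> Lp_fun M p" "g \<in> Lp_fun M p"
  shows "L (\<lambda>\<omega>. f \<omega> + g \<omega>) = L f + L g"
proof -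
  have "L (f + g) = L f + L g" using assms unfolding Lp_functional_def by blast
  then show ?thesis by (simp only: func_plus)
qed

lemma Lp_functional_scale:
  assumes "Lp_functional M p C L" "f \<in> Lp_fun M p"
  shows "L (\<lambda>\<omega>. c *\<^sub>R f \<omega>) = c * L f"
proof -
  have "L (c *\<^sub>R f) = c * L f" using assms unfolding Lp_functional_def by blast
  then show ?thesis by (simp only: scaleR_fun_def)
qed

lemma Lp_functional_cong:
  assumes L: "Lp_functional M p C L" and fg: "f \<in> Lp_fun M p" "g \<in> Lp_fun M p" and p: "0 < p"
    and eq: "\<And>\<omega>. \<omega> \<in> space M \<Longrightarrow> f \<omega> = g \<omega>"
  shows "L f = L g"
proof -
  have m: "(-1) *\<^sub>R g \<in> Lp_fun M p" using fg(2) by (rule Lp_fun_scaleR)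
  have "f + (-1) *\<^sub>R g \<in> Lp_fun M p" using Lp_fun_add[OF fg(1) m] p by simp
  moreover have "Lp_norm M p (f + (-1) *\<^sub>R g) = 0"
    using eq p by (simp add: Lp_norm_def scaleR_fun_def cong: Bochner_Integration.integral_cong)
  ultimately have "L (f + (-1) *\<^sub>R g) = 0" using L unfolding Lp_functional_def by fastforce
  moreover have "L (f + (-1) *\<^sub>R g) = L f + L ((-1) *\<^sub>R g)" "L ((-1) *\<^sub>R g) = (-1) * L g"
    using L fg m unfolding Lp_functional_def by blast+
  ultimately show ?thesis by simp
qed

text \<open>
The set function \<open>A \<mapsto> L(1\<^sub>A x)\<close> is bounded by a multiple of \<open>\<mu>(A)\<^bsup>1/p\<^esup>\<close>, the \<open>L\<^sup>p\<close>-norm of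
the indicator function of \<open>A\<close>.
\<close>

lemma density_family_exists:
  assumes L: "Lp_functional M p C L" and p: "0 < p" and C: "0 \<le> C"
  obtains d where "density_family M L d"
proof -
  have "\<exists>d. integrable M d \<and> (\<forall>A\<in>sets M. (LINT \<omega>:A|M. d \<omega>) = L (\<lambda>\<omega>. indicator A \<omega> *\<^sub>R x))" for x
  proof -
    let ?\<sigma> = "\<lambda>A. L (\<lambda>\<omega>. indicator A \<omega> *\<^sub>R x)"
    obtain d where "integrable M d" "\<And>A. A \<in> sets M \<Longrightarrow> (LINT \<omega>:A|M. d \<omega>) = ?\<sigma> A"
    proof (rule signed_density_exists[of ?\<sigma> "C * norm x" "1 / p"])
      fix A B assume AB: "A \<in> sets M" "B \<in> sets M" "A \<inter> B = {}"
      have "(\<lambda>\<omega>. (indicator (A \<union> B) \<omega> :: real) *\<^sub>R x) = (\<lambda>\<omega>. indicator A \<omega> *\<^sub>R x + indicator B \<omega> *\<^sub>R x)"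
        using AB(3) by (auto simp: fun_eq_iff split: split_indicator)
      then show "?\<sigma> (A \<union> B) = ?\<sigma> A + ?\<sigma> B"
        using Lp_functional_add[OF L indicator_scaleR_Lp[OF AB(1), of x] indicator_scaleR_Lp[OF AB(2), of x]]
        by simp
    next
      fix A assume A: "A \<in> sets M"
      have "(\<integral>\<omega>. norm ((indicator A \<omega> :: real) *\<^sub>R x) powr p \<partial>M) = (\<integral>\<omega>. indicator A \<omega> * norm x powr p \<partial>M)"
        by (rule Bochner_Integration.integral_cong) (auto split: split_indicator)
      also have "\<dots> = measure M A * norm x powr p" using A by simp
      finally have "Lp_norm M p (\<lambda>\<omega>. (indicator A \<omega> :: real) *\<^sub>R x) = norm x * measure M A powr (1 / p)"
        using p unfolding Lp_norm_def by (simp only:) (simp add: powr_mult powr_powr)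
      then show "\<bar>?\<sigma> A\<bar> \<le> C * norm x * measure M A powr (1 / p)"
        using L indicator_scaleR_Lp[OF A, of x p] unfolding Lp_functional_def by fastforce
    qed (use p C in auto)
    then show ?thesis by blast
  qed
  then have "\<forall>x. \<exists>d. integrable M d \<and> (\<forall>A\<in>sets M. (LINT \<omega>:A|M. d \<omega>) = L (\<lambda>\<omega>. indicator A \<omega> *\<^sub>R x))"
    by blast
  from choice[OF this] show thesis using that unfolding density_family_def by blast
qed

lemma density_family_add:
  assumes d: "density_family M L d" and L: "Lp_functional M p C L"
  shows "AE \<omega> in M. d (x + y) \<omega> = d x \<omega> + d y \<omega>"
proof (rule density_unique_real)
  show "integrable M (d (x + y))" "integrable M (\<lambda>\<omega>. d x \<omega> + d y \<omega>)"
    using d by (auto simp: density_family_def)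
  fix A assume A: "A \<in> sets M"
  have "(LINT \<omega>:A|M. d x \<omega> + d y \<omega>) = (LINT \<omega>:A|M. d x \<omega>) + (LINT \<omega>:A|M. d y \<omega>)"
    by (rule set_integral_add(2)[OF density_family_set_integrable[OF d A] density_family_set_integrable[OF d A]])
  also have "\<dots> = L (\<lambda>\<omega>. indicator A \<omega> *\<^sub>R x) + L (\<lambda>\<omega>. indicator A \<omega> *\<^sub>R y)"
    by (simp only: density_family_set_integral[OF d A])
  also have "\<dots> = L (\<lambda>\<omega>. indicator A \<omega> *\<^sub>R (x + y))"
    using Lp_functional_add[OF L indicator_scaleR_Lp[OF A, of x] indicator_scaleR_Lp[OF A, of y]]
    by (simp add: scaleR_add_right)
  finally show "(LINT \<omega>:A|M. d (x + y) \<omega>) = (LINT \<omega>:A|M. d x \<omega> + d y \<omega>)"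
    by (simp only: density_family_set_integral[OF d A])
qed

lemma density_family_scale:
  assumes d: "density_family M L d" and L: "Lp_functional M p C L"
  shows "AE \<omega> in M. d (c *\<^sub>R x) \<omega> = c * d x \<omega>"
proof (rule density_unique_real)
  show "integrable M (d (c *\<^sub>R x))" "integrable M (\<lambda>\<omega>. c * d x \<omega>)"
    using d by (auto simp: density_family_def)
  fix A assume A: "A \<in> sets M"
  have "L (\<lambda>\<omega>. indicator A \<omega> *\<^sub>R (c *\<^sub>R x)) = c * L (\<lambda>\<omega>. indicator A \<omega> *\<^sub>R x)"
    using Lp_functional_scale[OF L indicator_scaleR_Lp[OF A, of x], of c] by (simp add: mult.commute)
  then show "(LINT \<omega>:A|M. d (c *\<^sub>R x) \<omega>) = (LINT \<omega>:A|M. c * d x \<omega>)"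
    by (simp only: density_family_set_integral[OF d A] set_integral_mult_right)
qed

text \<open>
A simple function is a finite sum of indicator functions times vectors, on which linearity and the definition of
the densities apply term by term.
\<close>

lemma simple_function_density:
  assumes d: "density_family M L d" and L: "Lp_functional M p C L" and p: "0 < p"
    and f: "simple_function M f"
  shows "integrable M (\<lambda>\<omega>. d (f \<omega>) \<omega>)" "L f = (\<integral>\<omega>. d (f \<omega>) \<omega> \<partial>M)"
proof -
  define A where "A v = f -` {v} \<inter> space M" for v
  have A[measurable]: "A v \<in> sets M" for v
    unfolding A_def by (rule simple_functionD(2)[OF f])
  have fin: "finite (f ` space M)" by (rule simple_functionD(1)[OF f])
  have sum_ind: "(\<Sum>v\<in>f ` space M. (indicator (A v) \<omega> :: real) *\<^sub>R h v) = h (f \<omega>)"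
    if "\<omega> \<in> space M" for h :: "'b \<Rightarrow> 'c::real_vector" and \<omega>
  proof -
    have "(\<Sum>v\<in>f ` space M. (indicator (A v) \<omega> :: real) *\<^sub>R h v) = (\<Sum>v\<in>f ` space M. if v = f \<omega> then h v else 0)"
      using that by (intro sum.cong) (auto simp: A_def indicator_def)
    then show ?thesis using fin that by simp
  qed
  have int: "integrable M (\<lambda>\<omega>. indicator (A v) \<omega> *\<^sub>R d v \<omega>)" for v
    using d A by (intro integrable_mult_indicator) (auto simp: density_family_def)
  have eq: "(\<Sum>v\<in>f ` space M. indicator (A v) \<omega> *\<^sub>R d v \<omega>) = d (f \<omega>) \<omega>" if "\<omega> \<in> space M" for \<omega>
    using sum_ind[OF that, of "\<lambda>v. d v \<omega>"] .
  show "integrable M (\<lambda>\<omega>. d (f \<omega>) \<omega>)"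
  proof (subst Bochner_Integration.integrable_cong[OF refl eq[symmetric]])
    show "integrable M (\<lambda>\<omega>. \<Sum>v\<in>f ` space M. indicator (A v) \<omega> *\<^sub>R d v \<omega>)"
      by (intro Bochner_Integration.integrable_sum int)
  qed
  have Lsum: "(\<lambda>\<omega>. \<Sum>v\<in>S. (indicator (A v) \<omega> :: real) *\<^sub>R v) \<in> Lp_fun M p \<and>
      L (\<lambda>\<omega>. \<Sum>v\<in>S. (indicator (A v) \<omega> :: real) *\<^sub>R v) = (\<Sum>v\<in>S. \<integral>\<omega>. indicator (A v) \<omega> *\<^sub>R d v \<omega> \<partial>M)"
    if "finite S" for S
    using that
  proof induction
    case empty
    have "L (\<lambda>\<omega>. 0 *\<^sub>R 0) = 0 * L 0" using Lp_functional_scale[OF L Lp_fun_zero, of 0] by simp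
    then show ?case using Lp_fun_zero[of M p, where 'b = 'b] by (simp add: func_zero)
  next
    case (insert v S)
    have "L (\<lambda>\<omega>. indicator (A v) \<omega> *\<^sub>R v) = (\<integral>\<omega>. indicator (A v) \<omega> *\<^sub>R d v \<omega> \<partial>M)"
      using density_family_set_integral[OF d A, of v v] unfolding set_lebesgue_integral_def by (rule sym)
    moreover have "(\<lambda>\<omega>. \<Sum>u\<in>insert v S. (indicator (A u) \<omega> :: real) *\<^sub>R u)
        = (\<lambda>\<omega>. indicator (A v) \<omega> *\<^sub>R v + (\<Sum>u\<in>S. (indicator (A u) \<omega> :: real) *\<^sub>R u))"
      by (simp only: sum.insert[OF insert(1,2)])
    moreover have "\<dots> \<in> Lp_fun M p"
      using Lp_fun_add[OF indicator_scaleR_Lp[OF A] conjunct1[OF insert(3)], of v] p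
      by (simp only: func_plus less_imp_le)
    moreover note Lp_functional_add[OF L indicator_scaleR_Lp[OF A] conjunct1[OF insert(3)], of v v]
    ultimately show ?case
      by (simp only: sum.insert[OF insert(1,2)] conjunct2[OF insert(3)] simp_thms)
  qed
  have "L f = L (\<lambda>\<omega>. \<Sum>v\<in>f ` space M. (indicator (A v) \<omega> :: real) *\<^sub>R v)"
    using Lsum[OF fin] sum_ind[of _ "\<lambda>v. v"] simple_function_Lp[OF f] p
    by (intro Lp_functional_cong[OF L]) auto
  also have "\<dots> = (\<integral>\<omega>. (\<Sum>v\<in>f ` space M. indicator (A v) \<omega> *\<^sub>R d v \<omega>) \<partial>M)"
    using Lsum[OF fin] int by (subst Bochner_Integration.integral_sum) auto
  also have "\<dots> = (\<integral>\<omega>. d (f \<omega>) \<omega> \<partial>M)"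
    using eq by (rule Bochner_Integration.integral_cong[OF refl])
  finally show "L f = (\<integral>\<omega>. d (f \<omega>) \<omega> \<partial>M)" .
qed

text \<open>
One half of the interchange of supremum and integral: a function \<open>v\<close> that dominates the conjugate
integrand on \<open>D\<close> has an integral that dominates the value of the conjugate functional at each \<open>D\<close>-valued simple
function.
\<close>

lemma simple_function_conjugate_le:
  assumes d: "density_family M L d" and L: "Lp_functional M p C L" and p: "0 < p"
    and s: "simple_function M s" "\<And>\<omega>. \<omega> \<in> space M \<Longrightarrow> s \<omega> \<in> D"
    and v: "integrable M v" "AE \<omega> in M. \<forall>x\<in>D. d x \<omega> - norm x powr p / p \<le> v \<omega>"
  shows "L s - (\<integral>\<omega>. norm (s \<omega>) powr p \<partial>M) / p \<le> (\<integral>\<omega>. v \<omega> \<partial>M)"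
proof -
  note int = simple_function_density[OF d L p s(1)]
    simple_function_integrable[OF s(1), of "\<lambda>x. norm x powr p"]
  have "L s - (\<integral>\<omega>. norm (s \<omega>) powr p \<partial>M) / p = (\<integral>\<omega>. d (s \<omega>) \<omega> - norm (s \<omega>) powr p / p \<partial>M)"
    using int by simp
  also have "\<dots> \<le> (\<integral>\<omega>. v \<omega> \<partial>M)"
  proof (rule integral_mono_AE)
    show "AE \<omega> in M. d (s \<omega>) \<omega> - norm (s \<omega>) powr p / p \<le> v \<omega>"
      using v(2) AE_space by eventually_elim (use s(2) in auto)
  qed (use int v in auto)
  finally show ?thesis .
qed

lemma Lp_functional_conjugate_bound:
  assumes L: "Lp_functional M p C L" and pq: "1 < p" "1 < q" "1 / p + 1 / q = 1" and C: "0 \<le> C"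
    and f: "f \<in> Lp_fun M p"
  shows "L f - (\<integral>\<omega>. norm (f \<omega>) powr p \<partial>M) / p \<le> C powr q / q"
proof -
  have "L f \<le> Lp_norm M p f * C"
    using L f unfolding Lp_functional_def by (fastforce simp: mult.commute)
  also have "\<dots> \<le> Lp_norm M p f powr p / p + C powr q / q"
    using pq C by (intro Youngs_inequality) (auto simp: Lp_norm_nonneg)
  finally show ?thesis using pq by (simp add: Lp_norm_powr)
qed

text \<open>
The other half of the interchange. The maximum of the first \<open>m + 1\<close> terms is attained at \<open>y (\<kappa> m \<omega>)\<close> for a
simple index function \<open>\<kappa> m\<close>, so its integral is a value of the conjugate functional, which Young's inequality
bounds by \<open>C\<^sup>q / q\<close>. Monotone convergence gives the supremum. The requirement \<open>y 0 = 0\<close> makes all these maxima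
nonnegative almost everywhere.
\<close>

lemma nn_integral_conjugate_le:
  fixes y :: "nat \<Rightarrow> 'b::real_normed_vector"
  assumes d: "density_family M L d" and L: "Lp_functional M p C L"
    and pq: "1 < p" "1 < q" "1 / p + 1 / q = 1" and C: "0 \<le> C" and y0: "y 0 = 0"
  shows "(\<integral>\<^sup>+\<omega>. (SUP k. ennreal (d (y k) \<omega> - norm (y k) powr p / p)) \<partial>M) \<le> ennreal (C powr q / q)"
proof -
  define g where "g k \<omega> = d (y k) \<omega> - norm (y k) powr p / p" for k \<omega>
  have [measurable]: "g k \<in> borel_measurable M" for k
  proof -
    have [measurable]: "d (y k) \<in> borel_measurable M" using d by (auto simp: density_family_def)
    show ?thesis unfolding g_def by measurable
  qed
  \<comment> \<open>\<open>\<kappa> m \<omega>\<close> is the first index at which \<open>g 0 \<omega>, ..., g m \<omega>\<close> is maximal.\<close>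
  define \<kappa> where "\<kappa> m \<omega> = rec_nat 0 (\<lambda>m i. if g i \<omega> < g (Suc m) \<omega> then Suc m else i) m" for m \<omega>
  have \<kappa>_simps: "\<kappa> 0 \<omega> = 0" "\<kappa> (Suc m) \<omega> = (if g (\<kappa> m \<omega>) \<omega> < g (Suc m) \<omega> then Suc m else \<kappa> m \<omega>)" for m \<omega>
    by (simp_all add: \<kappa>_def)
  have \<kappa>_simple: "simple_function M (\<kappa> m)" for m
  proof (induction m)
    case 0
    then show ?case by (simp add: \<kappa>_simps)
  next
    case (Suc m)
    have [measurable]: "\<kappa> m \<in> measurable M (count_space UNIV)"
      using Suc by (rule measurable_simple_function)
    have [measurable]: "(\<lambda>\<omega>. g (\<kappa> m \<omega>) \<omega>) \<in> borel_measurable M"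
      by (rule measurable_compose_countable) measurable
    have "{\<omega> \<in> space M. g (\<kappa> m \<omega>) \<omega> < g (Suc m) \<omega>} \<in> sets M" by measurable
    then show ?case unfolding \<kappa>_simps using Suc by (intro simple_function_If) auto
  qed
  define G where "G m \<omega> = g (\<kappa> m \<omega>) \<omega>" for m \<omega>
  have G_Suc: "G m \<omega> \<le> G (Suc m) \<omega>" "g (Suc m) \<omega> \<le> G (Suc m) \<omega>" for m \<omega>
    by (auto simp: G_def \<kappa>_simps)
  have G_mono: "G m \<omega> \<le> G n \<omega>" if "m \<le> n" for m n \<omega>
    by (rule lift_Suc_mono_le[of "\<lambda>m. G m \<omega>", OF G_Suc(1) that])
  have g_le_G: "g k \<omega> \<le> G k \<omega>" for k \<omega>
    using G_Suc(2) by (cases k) (auto simp: G_def \<kappa>_simps)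
  have "AE \<omega> in M. d 0 \<omega> = 0" using density_family_scale[OF d L, of 0 0] by simp
  then have G_nonneg: "AE \<omega> in M. 0 \<le> G m \<omega>" for m
  proof eventually_elim
    case (elim \<omega>)
    have "G 0 \<omega> = 0" using elim by (simp add: G_def g_def \<kappa>_simps y0)
    then show ?case using G_mono[of 0 m \<omega>] by simp
  qed
  have G_le: "(\<integral>\<^sup>+\<omega>. ennreal (G m \<omega>) \<partial>M) \<le> ennreal (C powr q / q)" for m
  proof -
    have s: "simple_function M (\<lambda>\<omega>. y (\<kappa> m \<omega>))" by (rule simple_function_compose1[OF \<kappa>_simple])
    have p: "0 < p" using pq by simp
    note int = simple_function_density[OF d L p s]
      simple_function_integrable[OF s, of "\<lambda>x. norm x powr p"]
    have "integrable M (G m)" "(\<integral>\<omega>. G m \<omega> \<partial>M)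
        = L (\<lambda>\<omega>. y (\<kappa> m \<omega>)) - (\<integral>\<omega>. norm (y (\<kappa> m \<omega>)) powr p \<partial>M) / p"
      unfolding G_def[abs_def] g_def using int by auto
    then show ?thesis
      using Lp_functional_conjugate_bound[OF L pq C simple_function_Lp[OF s]] G_nonneg
      by (simp add: nn_integral_eq_integral ennreal_leI)
  qed
  have [measurable]: "G m \<in> borel_measurable M" for m
  proof -
    have [measurable]: "\<kappa> m \<in> measurable M (count_space UNIV)"
      using \<kappa>_simple by (rule measurable_simple_function)
    show ?thesis unfolding G_def[abs_def] by (rule measurable_compose_countable) measurable
  qed
  have "(\<integral>\<^sup>+\<omega>. (SUP k. ennreal (g k \<omega>)) \<partial>M) \<le> (\<integral>\<^sup>+\<omega>. (SUP m. ennreal (G m \<omega>)) \<partial>M)"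
    by (intro nn_integral_mono SUP_mono) (use g_le_G in \<open>auto intro: ennreal_leI\<close>)
  also have "\<dots> = (SUP m. \<integral>\<^sup>+\<omega>. ennreal (G m \<omega>) \<partial>M)"
    by (rule nn_integral_monotone_convergence_SUP)
      (auto simp: incseq_def le_fun_def intro!: ennreal_leI G_mono)
  also have "\<dots> \<le> ennreal (C powr q / q)" by (rule SUP_least[OF G_le])
  finally show ?thesis unfolding g_def .
qed

text \<open>
The function \<open>V\<close> is the pointwise supremum, with value \<open>0\<close> on the null sets where this is negative or
infinite. The last two properties say that it is the least nonnegative upper bound.
\<close>

lemma conjugate_integrand_exists:
  fixes y :: "nat \<Rightarrow> 'b::real_normed_vector"
  assumes d: "density_family M L d" and L: "Lp_functional M p C L"
    and pq: "1 < p" "1 < q" "1 / p + 1 / q = 1" and C: "0 \<le> C" and y0: "y 0 = 0"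
  obtains V where "integrable M V" "(\<integral>\<omega>. V \<omega> \<partial>M) \<le> C powr q / q" "\<And>\<omega>. 0 \<le> V \<omega>"
    "AE \<omega> in M. \<forall>k. d (y k) \<omega> - norm (y k) powr p / p \<le> V \<omega>"
    "\<And>\<omega> b. 0 \<le> b \<Longrightarrow> (\<And>k. d (y k) \<omega> - norm (y k) powr p / p \<le> b) \<Longrightarrow> V \<omega> \<le> b"
proof -
  define U where "U \<omega> = (SUP k. ennreal (d (y k) \<omega> - norm (y k) powr p / p))" for \<omega>
  have [measurable]: "d (y k) \<in> borel_measurable M" for k using d by (auto simp: density_family_def)
  have [measurable]: "U \<in> borel_measurable M" unfolding U_def by measurable
  have nn: "(\<integral>\<^sup>+\<omega>. U \<omega> \<partial>M) \<le> ennreal (C powr q / q)"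
    unfolding U_def by (rule nn_integral_conjugate_le[where y = y, OF d L pq C y0])
  then have "(\<integral>\<^sup>+\<omega>. U \<omega> \<partial>M) \<noteq> \<infinity>" by (auto simp: top_unique)
  then have fin: "AE \<omega> in M. U \<omega> \<noteq> \<infinity>" by (intro nn_integral_PInf_AE) auto
  have "AE \<omega> in M. ennreal (enn2real (U \<omega>)) = U \<omega>"
    using fin by eventually_elim (simp add: less_top)
  then have eq: "(\<integral>\<^sup>+\<omega>. ennreal (enn2real (U \<omega>)) \<partial>M) = (\<integral>\<^sup>+\<omega>. U \<omega> \<partial>M)"
    by (rule nn_integral_cong_AE)
  show thesis
  proof (rule that[of "\<lambda>\<omega>. enn2real (U \<omega>)"])
    show int: "integrable M (\<lambda>\<omega>. enn2real (U \<omega>))"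
      using nn eq by (intro integrableI_nonneg) (auto intro: le_less_trans)
    have "ennreal (\<integral>\<omega>. enn2real (U \<omega>) \<partial>M) \<le> ennreal (C powr q / q)"
      using nn eq int by (simp flip: nn_integral_eq_integral)
    then show "(\<integral>\<omega>. enn2real (U \<omega>) \<partial>M) \<le> C powr q / q"
      using pq by (subst (asm) ennreal_le_iff) auto
    show "AE \<omega> in M. \<forall>k. d (y k) \<omega> - norm (y k) powr p / p \<le> enn2real (U \<omega>)"
      using fin
    proof eventually_elim
      case (elim \<omega>)
      have "ennreal (d (y k) \<omega> - norm (y k) powr p / p) \<le> U \<omega>" for k
        unfolding U_def by (rule SUP_upper) simp
      moreover have "U \<omega> = ennreal (enn2real (U \<omega>))" using elim by (simp add: less_top)
      ultimately have "ennreal (d (y k) \<omega> - norm (y k) powr p / p) \<le> ennreal (enn2real (U \<omega>))" for k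
        by metis
      then show ?case by (simp add: ennreal_le_iff)
    qed
    fix \<omega> and b :: real assume "0 \<le> b" "\<And>k. d (y k) \<omega> - norm (y k) powr p / p \<le> b"
    then have "U \<omega> \<le> ennreal b" unfolding U_def by (intro SUP_least ennreal_leI) auto
    then show "enn2real (U \<omega>) \<le> b" using \<open>0 \<le> b\<close> by (intro enn2real_leI)
  qed simp
qed

end

section \<open>Second differences of convex functions\<close>

text \<open>
The difference quotients of a convex function increase with \<open>t\<close>, so the one-sided limits at \<open>0\<close> exist,
and the gap between the quotients at \<open>1/n\<close> and \<open>- 1/n\<close> is the second difference divided by \<open>1/n\<close>.
\<close>

lemma convex_differentiable_at_0:
  fixes F :: "real \<Rightarrow> real"
  assumes F: "convex_on UNIV F"
    and sym: "(\<lambda>n. (F (1 / real (Suc n)) + F (- (1 / real (Suc n))) - 2 * F 0) * real (Suc n)) \<longlonglongrightarrow> 0"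
  shows "\<exists>l. ((\<lambda>t. (F t - F 0) / t) \<longlongrightarrow> l) (at 0)"
proof -
  define s where "s t = (F t - F 0) / t" for t
  have s_neg: "(F 0 - F t) / (0 - t) = s t" "(F t - F 0) / (t - 0) = s t" for t
    by (simp_all add: s_def minus_divide_left)
  have mono: "s u \<le> s v" if uv: "u < v" "u \<noteq> 0" "v \<noteq> 0" for u v
  proof -
    consider "0 < u" | "v < 0" | "u < 0" "0 < v" using uv by linarith
    then show ?thesis
    proof cases
      case 1
      show ?thesis
        using convex_on_slope_le(1)[OF F UNIV_I UNIV_I 1 uv(1)] by (simp only: s_neg)
    next
      case 2
      show ?thesis
        using convex_on_slope_le(2)[OF F UNIV_I UNIV_I uv(1) 2] by (simp only: s_neg)
    next
      case 3
      show ?thesis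
        using order_trans[OF convex_on_slope_le[OF F UNIV_I UNIV_I 3]] by (simp only: s_neg)
    qed
  qed
  define \<tau> where "\<tau> n = 1 / real (Suc n)" for n
  have \<tau>: "0 < \<tau> n" for n by (simp add: \<tau>_def)
  define r where "r = (INF t\<in>{0<..}. s t)"
  have bdd: "bdd_below (s ` {0<..})"
    by (rule bdd_belowI2[where m = "s (-1)"]) (auto intro: mono)
  have r_le: "r \<le> s t" if "0 < t" for t
    unfolding r_def using that by (intro cINF_lower bdd) auto
  have le_r: "s t \<le> r" if "t < 0" for t
    unfolding r_def using that by (intro cINF_greatest) (auto intro: mono)
  have gap: "s (\<tau> n) - s (- \<tau> n) = (F (1 / real (Suc n)) + F (- (1 / real (Suc n))) - 2 * F 0) * real (Suc n)" for n
    by (simp add: s_def \<tau>_def algebra_simps)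
  have "((\<lambda>t. s t) \<longlongrightarrow> r) (at 0)"
  proof (rule LIM_I)
    fix \<epsilon> :: real assume \<epsilon>: "0 < \<epsilon>"
    have "eventually (\<lambda>n. s (\<tau> n) - s (- \<tau> n) < \<epsilon>) sequentially"
      using order_tendstoD(2)[OF sym \<epsilon>] by (simp only: gap)
    then obtain n where n: "s (\<tau> n) - s (- \<tau> n) < \<epsilon>" by (auto simp: eventually_sequentially)
    show "\<exists>\<delta>>0. \<forall>t. t \<noteq> 0 \<and> norm (t - 0) < \<delta> \<longrightarrow> norm (s t - r) < \<epsilon>"
    proof (intro exI conjI allI impI)
      fix t :: real assume t: "t \<noteq> 0 \<and> norm (t - 0) < \<tau> n"
      then have "s (- \<tau> n) \<le> s t" "s t \<le> s (\<tau> n)"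
        using \<tau>[of n] by (auto intro!: mono)
      then show "norm (s t - r) < \<epsilon>"
        using n r_le[OF \<tau>[of n]] le_r[of "- \<tau> n"] \<tau>[of n] by simp
    qed (rule \<tau>)
  qed
  then show ?thesis unfolding s_def by blast
qed

text \<open>
The graph of the \<open>q\<close>-th power lies above its tangents: this is Young's inequality for
\<open>x\<close> and \<open>y\<^bsup>q-1\<^esup>\<close>.
\<close>

lemma powr_above_tangent:
  fixes q :: real
  assumes q: "1 < q" and x: "0 \<le> x" and y: "0 < y"
  shows "q * y powr (q - 1) * (x - y) \<le> x powr q - y powr q"
proof -
  define p where "p = q / (q - 1)"
  have p: "1 < p" "1 / q + 1 / p = 1" "(q - 1) * p = q"
    using q by (auto simp: p_def field_simps)
  have "x * y powr (q - 1) \<le> x powr q / q + (y powr (q - 1)) powr p / p"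
    using q p x by (intro Youngs_inequality) auto
  also have "(y powr (q - 1)) powr p = y powr q" by (simp add: powr_powr p(3))
  also have "y powr q / p = y powr q * (1 / p)" by simp
  also have "1 / p = 1 - 1 / q" using p(2) by simp
  finally have "q * (x * y powr (q - 1)) \<le> x powr q + y powr q * (q - 1)"
    using q by (simp add: field_simps)
  moreover have "y powr q = y powr (q - 1) * y"
    using y powr_add[of y "q - 1" 1] by simp
  ultimately show ?thesis by (simp add: algebra_simps)
qed

text \<open>
At \<open>a \<noteq> 0\<close> this is the chain rule. At \<open>a = 0\<close>, where the norm need not be differentiable, the quotient is
of order \<open>\<bar>t\<bar>\<^bsup>q-1\<^esup>\<close>.
\<close>

lemma norm_power_second_difference:
  fixes a b :: "'v::real_normed_vector"
  assumes G: "gateaux_differentiable (UNIV :: 'v set) norm" and q: "1 < q"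
  shows "((\<lambda>t. (norm (a + t *\<^sub>R b) powr q + norm (a + (- t) *\<^sub>R b) powr q - 2 * norm a powr q) / t) \<longlongrightarrow> 0) (at 0)"
proof (cases "a = 0")
  case True
  have lim: "((\<lambda>t. 2 * norm b powr q * \<bar>t\<bar> powr (q - 1)) \<longlongrightarrow> 2 * norm b powr q * 0) (at (0::real))"
    using q by (intro tendsto_mult tendsto_const tendsto_zero_powrI tendsto_rabs_zero tendsto_ident_at) auto
  show ?thesis
  proof (rule Lim_null_comparison)
    have "\<bar>(\<bar>t\<bar> * norm b) powr q + (\<bar>t\<bar> * norm b) powr q\<bar> / \<bar>t\<bar> = 2 * norm b powr q * \<bar>t\<bar> powr (q - 1)"
      if "t \<noteq> 0" for t
      using that powr_add[of "\<bar>t\<bar>" "q - 1" 1] by (simp add: powr_mult field_simps)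
    then show "eventually (\<lambda>t. norm ((norm (a + t *\<^sub>R b) powr q + norm (a + (- t) *\<^sub>R b) powr q - 2 * norm a powr q) / t)
        \<le> 2 * norm b powr q * \<bar>t\<bar> powr (q - 1)) (at 0)"
      using True q by (intro eventually_at_filter[THEN iffD2] always_eventually) auto
  qed (use lim in simp)
next
  case False
  define f where "f t = norm (a + t *\<^sub>R b) powr q" for t
  obtain l where "((\<lambda>t. (norm (a + t *\<^sub>R b) - norm a) / t) \<longlongrightarrow> l) (at 0)"
    using G False unfolding gateaux_differentiable_def by blast
  then have "DERIV (\<lambda>t. norm (a + t *\<^sub>R b)) 0 :> l"
    by (simp add: DERIV_def)
  from DERIV_fun_powr[OF this, of q] obtain D where "DERIV f 0 :> D"
    using False by (auto simp: f_def[abs_def])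
  then have D: "((\<lambda>t. (f t - f 0) / t) \<longlongrightarrow> D) (at 0)" by (simp add: DERIV_def)
  have "filterlim uminus (at 0) (at (0::real))"
    by (rule filterlim_atI) (auto intro!: tendsto_eq_intros simp: eventually_at_filter)
  from filterlim_compose[OF D this]
  have "((\<lambda>t. (f (- t) - f 0) / (- t)) \<longlongrightarrow> D) (at 0)" .
  from tendsto_diff[OF D this]
  have "((\<lambda>t. (f t - f 0) / t - (f (- t) - f 0) / (- t)) \<longlongrightarrow> 0) (at 0)" by simp
  moreover have "(f t - f 0) / t - (f (- t) - f 0) / (- t) = (f t + f (- t) - 2 * f 0) / t" for t
    by (simp add: add_divide_distrib diff_divide_distrib)
  ultimately show ?thesis by (simp add: f_def)
qed

text \<open>
The supremum over \<open>s\<close> of \<open>s \<alpha> - s\<^sup>p / p\<close> is \<open>\<alpha>\<^sup>q / q\<close>, attained at \<open>s = \<alpha>\<^bsup>q-1\<^esup>\<close>. So a bound on the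
conjugate function on all multiples of \<open>x\<close> bounds \<open>\<alpha> = a x / \<parallel>x\<parallel>\<close>; real multiples are limits of rational
ones.
\<close>

lemma conjugate_bound_imp_norm_bound:
  fixes a :: "'a::real_normed_vector \<Rightarrow> real"
  assumes pq: "1 < p" "1 < q" "1 / p + 1 / q = 1" and v: "0 \<le> v"
    and D: "rational_subspace D" and a: "rational_linear_on D a"
    and bound: "\<And>x. x \<in> D \<Longrightarrow> a x - norm x powr p / p \<le> v"
    and x: "x \<in> D"
  shows "a x \<le> (q * v) powr (1 / q) * norm x"
proof -
  have Dscale: "\<And>r x. r \<in> \<rat> \<Longrightarrow> x \<in> D \<Longrightarrow> r *\<^sub>R x \<in> D"
    and scale: "\<And>r x. r \<in> \<rat> \<Longrightarrow> x \<in> D \<Longrightarrow> a (r *\<^sub>R x) = r * a x"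
    using D a by (auto simp: rational_subspace_def rational_linear_on_def)
  have real_scale: "s * a x - (\<bar>s\<bar> * norm x) powr p / p \<le> v" for s :: real
  proof -
    obtain r where r: "\<And>n. r n \<in> \<rat>" "r \<longlonglongrightarrow> s"
      using closure_sequential[of s "\<rat>"] Rats_closure_real by auto
    have "(\<lambda>n. r n * a x - (\<bar>r n\<bar> * norm x) powr p / p) \<longlonglongrightarrow> s * a x - (\<bar>s\<bar> * norm x) powr p / p"
      using pq by (intro tendsto_diff tendsto_mult tendsto_divide tendsto_powr2 tendsto_rabs r(2) tendsto_const) auto
    moreover have "r n * a x - (\<bar>r n\<bar> * norm x) powr p / p \<le> v" for n
      using bound[OF Dscale[OF r(1) x, of n]] scale[OF r(1) x, of n] by simp
    ultimately show ?thesis by (intro LIMSEQ_le_const2) auto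
  qed
  show ?thesis
  proof (cases "a x \<le> 0")
    case True
    then show ?thesis by (meson mult_nonneg_nonneg norm_ge_zero order_trans powr_ge_zero)
  next
    case False
    have "x \<noteq> 0" using scale[of 0 x] x False by auto
    then have n: "0 < norm x" by simp
    define \<alpha> where "\<alpha> = a x / norm x"
    have \<alpha>: "0 < \<alpha>" "a x = \<alpha> * norm x" using False n by (auto simp: \<alpha>_def)
    have qp: "(q - 1) * p = q" using pq by (simp add: field_simps)
    have "(\<alpha> powr (q - 1) / norm x) * a x = \<alpha> powr q"
      using n \<alpha> powr_add[of \<alpha> "q - 1" 1] by simp
    moreover have "(\<bar>\<alpha> powr (q - 1) / norm x\<bar> * norm x) powr p = \<alpha> powr q"
      using n by (simp add: powr_powr qp)
    ultimately have "\<alpha> powr q - \<alpha> powr q / p \<le> v"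
      using real_scale[of "\<alpha> powr (q - 1) / norm x"] by simp
    moreover have "\<alpha> powr q - \<alpha> powr q / p = \<alpha> powr q * (1 - 1 / p)" by (simp add: algebra_simps)
    moreover have "1 - 1 / p = 1 / q" using pq by simp
    ultimately have "\<alpha> powr q \<le> q * v" using pq by (simp add: field_simps)
    then have "(\<alpha> powr q) powr (1 / q) \<le> (q * v) powr (1 / q)"
      using pq by (intro powr_mono2) auto
    then have "\<alpha> \<le> (q * v) powr (1 / q)" using \<alpha> pq by (simp add: powr_powr)
    then show ?thesis using n \<alpha> by simp
  qed
qed

text \<open>
Think of \<open>V t\<close> as \<open>\<parallel>a + t b\<parallel>\<^sup>q / q\<close>, the norm being taken over \<open>D\<close> alone. Norm-preserving extension of
\<open>a\<close> makes \<open>V\<close> touch \<open>H t = \<parallel>A + t B\<parallel>\<^sup>q / q\<close> at \<open>0\<close> from below, so its second differences at \<open>0\<close> are at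
most those of \<open>H\<close>. A bounded extension \<open>B\<close> of \<open>b\<close> is enough, and it is obtained from one of \<open>a + b\<close>.
\<close>

lemma conjugate_second_difference:
  fixes a b :: "'a::real_normed_vector \<Rightarrow> real" and V :: "real \<Rightarrow> real"
  assumes G: "gateaux_differentiable (UNIV :: ('a \<Rightarrow>\<^sub>L real) set) norm"
    and pq: "1 < p" "1 < q" "1 / p + 1 / q = 1"
    and D: "rational_subspace D" and a: "rational_linear_on D a" and b: "rational_linear_on D b"
    and nonneg: "\<And>t. 0 \<le> V t"
    and upper0: "\<And>x. x \<in> D \<Longrightarrow> a x - norm x powr p / p \<le> V 0"
    and upper1: "\<And>x. x \<in> D \<Longrightarrow> a x + b x - norm x powr p / p \<le> V 1"
    and least: "\<And>t c. 0 \<le> c \<Longrightarrow> (\<And>x. x \<in> D \<Longrightarrow> a x + t * b x - norm x powr p / p \<le> c) \<Longrightarrow> V t \<le> c"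
    and lower: "\<And>n. 2 * V 0 \<le> V (1 / real (Suc n)) + V (- (1 / real (Suc n)))"
  shows "(\<lambda>n. (V (1 / real (Suc n)) + V (- (1 / real (Suc n))) - 2 * V 0) * real (Suc n)) \<longlonglongrightarrow> 0"
proof -
  have "a x \<le> (q * V 0) powr (1 / q) * norm x" if "x \<in> D" for x
    by (rule conjugate_bound_imp_norm_bound[OF pq nonneg D a upper0 that])
  from extend_rational_linear[OF D a this powr_ge_zero]
  obtain A :: "'a \<Rightarrow>\<^sub>L real" where A: "\<And>x. x \<in> D \<Longrightarrow> A x = a x" "norm A \<le> (q * V 0) powr (1 / q)"
    by blast
  note ab = rational_linear_on_add[OF a b]
  have "a x + b x \<le> (q * V 1) powr (1 / q) * norm x" if "x \<in> D" for x
    by (rule conjugate_bound_imp_norm_bound[OF pq nonneg D ab upper1 that])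
  from extend_rational_linear[OF D ab this powr_ge_zero]
  obtain S :: "'a \<Rightarrow>\<^sub>L real" where S: "\<And>x. x \<in> D \<Longrightarrow> S x = a x + b x"
    by blast
  define B where "B = S - A"
  have B: "B x = b x" if "x \<in> D" for x using A(1)[OF that] S[OF that] by (simp add: B_def blinfun.diff_left)
  define H where "H t = norm (A + t *\<^sub>R B) powr q / q" for t
  have V_le: "V t \<le> H t" for t
  proof (rule least)
    show "0 \<le> H t" using pq by (simp add: H_def)
    fix x assume x: "x \<in> D"
    have "(A + t *\<^sub>R B) x \<le> norm x * norm (A + t *\<^sub>R B)"
      using norm_blinfun[of "A + t *\<^sub>R B" x] by (simp add: mult.commute)
    also have "\<dots> \<le> norm x powr p / p + H t"
      unfolding H_def using pq by (intro Youngs_inequality) auto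
    finally show "a x + t * b x - norm x powr p / p \<le> H t"
      using A(1)[OF x] B[OF x] by (simp add: blinfun.add_left blinfun.scaleR_left)
  qed
  have "norm A powr q \<le> ((q * V 0) powr (1 / q)) powr q"
    using A(2) pq by (intro powr_mono2) auto
  also have "\<dots> = q * V 0" using pq nonneg[of 0] by (simp add: powr_powr)
  finally have H0: "H 0 \<le> V 0" using pq by (simp add: H_def field_simps)
  have "filterlim (\<lambda>n. 1 / real (Suc n)) (at 0) sequentially"
    by (rule filterlim_atI) (use LIMSEQ_inverse_real_of_nat in \<open>auto simp: inverse_eq_divide\<close>)
  from filterlim_compose[OF norm_power_second_difference[OF G pq(2), of A B] this]
  have "(\<lambda>n. (norm (A + (1 / real (Suc n)) *\<^sub>R B) powr q + norm (A + (- (1 / real (Suc n))) *\<^sub>R B) powr q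
      - 2 * norm A powr q) / (1 / real (Suc n)) / q) \<longlonglongrightarrow> 0 / q"
    using pq by (intro tendsto_divide tendsto_const) auto
  then have lim: "(\<lambda>n. (H (1 / real (Suc n)) + H (- (1 / real (Suc n))) - 2 * H 0) * real (Suc n)) \<longlonglongrightarrow> 0"
    by (simp add: H_def add_divide_distrib diff_divide_distrib algebra_simps)
  show ?thesis
  proof (rule tendsto_sandwich[OF _ _ tendsto_const lim])
    show "eventually (\<lambda>n. 0 \<le> (V (1 / real (Suc n)) + V (- (1 / real (Suc n))) - 2 * V 0) * real (Suc n)) sequentially"
      using lower by (intro always_eventually allI mult_nonneg_nonneg) auto
    have "V (1 / real (Suc n)) + V (- (1 / real (Suc n))) - 2 * V 0
        \<le> H (1 / real (Suc n)) + H (- (1 / real (Suc n))) - 2 * H 0" for n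
      using V_le[of "1 / real (Suc n)"] V_le[of "- (1 / real (Suc n))"] H0 by linarith
    then show "eventually (\<lambda>n. (V (1 / real (Suc n)) + V (- (1 / real (Suc n))) - 2 * V 0) * real (Suc n)
        \<le> (H (1 / real (Suc n)) + H (- (1 / real (Suc n))) - 2 * H 0) * real (Suc n)) sequentially"
      by (intro always_eventually allI mult_right_mono) auto
  qed
qed

section \<open>Smoothness of the dual norm\<close>

text \<open>
If the conjugate functional is at most \<open>c\<close> on simple functions, then by density everywhere; evaluating it at
suitable multiples of functions in the unit ball recovers the norm.
\<close>

lemma Lp_dual_norm_conjugate_le:
  fixes \<phi> :: "('w \<Rightarrow> 'a::real_normed_vector) set \<Rightarrow> real"
  assumes fin: "finite_measure M" and \<phi>: "\<phi> \<in> Lp_dual M p"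
    and pq: "1 < p" "1 < q" "1 / p + 1 / q = 1"
    and c: "\<And>s. simple_function M s \<Longrightarrow> \<phi> (Lp_class M p s) - (\<integral>\<omega>. norm (s \<omega>) powr p \<partial>M) / p \<le> c"
  shows "Lp_dual_norm M p \<phi> powr q / q \<le> c"
proof -
  let ?L = "\<lambda>f. \<phi> (Lp_class M p f)"
  have p: "0 < p" using pq by simp
  note L = Lp_dual_functional[OF \<phi> p]
  have all: "?L f - (\<integral>\<omega>. norm (f \<omega>) powr p \<partial>M) / p \<le> c" if "f \<in> Lp_fun M p" for f
  proof (rule ccontr)
    assume "\<not> ?thesis"
    then show False
      using Lp_functional_simple_approx[OF fin L p that, of c] c by (metis not_le)
  qed
  have L_scale: "?L (r *\<^sub>R f) = r * ?L f" if "f \<in> Lp_fun M p" for r f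
    using L that unfolding Lp_functional_def by blast
  have qp: "(q - 1) * p = q" using pq by (simp add: field_simps)
  have "\<bar>?L f\<bar> \<le> (q * c) powr (1 / q)" if f: "f \<in> Lp_fun M p" "Lp_norm M p f \<le> 1" for f
  proof (cases "?L f = 0")
    case False
    define m where "m = \<bar>?L f\<bar>"
    have m: "0 < m" using False by (simp add: m_def)
    \<comment> \<open>Among the multiples of \<open>f\<close> with a fixed bound for the norm this one is optimal: its value is
      \<open>m\<^sup>q\<close>, and the \<open>p\<close>-th power of its norm is at most \<open>m\<^sup>q\<close> as well.\<close>
    define r where "r = sgn (?L f) * m powr (q - 1)"
    have "?L (r *\<^sub>R f) = m powr (q - 1) * m"
      unfolding L_scale[OF f(1)] by (simp add: r_def m_def mult_sgn_abs algebra_simps sgn_mult_self_eq abs_sgn)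
    then have L_eq: "?L (r *\<^sub>R f) = m powr q" using m powr_add[of m "q - 1" 1] by simp
    have "\<bar>r\<bar> = m powr (q - 1)" using False by (simp add: r_def abs_mult abs_sgn_eq)
    then have "Lp_norm M p (r *\<^sub>R f) \<le> m powr (q - 1) * 1"
      unfolding Lp_norm_scaleR[OF p] using f(2) by (simp only:) (rule mult_left_mono, auto)
    then have "Lp_norm M p (r *\<^sub>R f) powr p \<le> (m powr (q - 1)) powr p"
      using p by (intro powr_mono2) (auto simp: Lp_norm_nonneg)
    then have "(\<integral>\<omega>. norm ((r *\<^sub>R f) \<omega>) powr p \<partial>M) / p \<le> m powr q / p"
      using p by (simp only: Lp_norm_powr[OF p] powr_powr qp divide_right_mono less_imp_le)
    then have "m powr q - m powr q / p \<le> c"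
      using all[OF Lp_fun_scaleR[OF f(1)], of r] L_eq by linarith
    moreover have "m powr q - m powr q / p = m powr q * (1 - 1 / p)" by (simp add: algebra_simps)
    moreover have "1 - 1 / p = 1 / q" using pq by simp
    ultimately have "m powr q \<le> q * c" using pq by (simp add: field_simps)
    then have "(m powr q) powr (1 / q) \<le> (q * c) powr (1 / q)" using pq by (intro powr_mono2) auto
    then show ?thesis using m pq by (simp add: powr_powr m_def)
  qed simp
  then have "Lp_dual_norm M p \<phi> \<le> (q * c) powr (1 / q)" by (rule Lp_dual_norm_least)
  then have "Lp_dual_norm M p \<phi> powr q \<le> ((q * c) powr (1 / q)) powr q"
    using pq Lp_dual_norm_nonneg[OF \<phi>] by (intro powr_mono2) auto
  moreover have "0 \<le> c"
  proof -
    have "?L 0 = 0" using L_scale[OF Lp_fun_zero, of 0] by simp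
    then show ?thesis using all[OF Lp_fun_zero] by simp
  qed
  ultimately show ?thesis using pq by (simp add: powr_powr field_simps)
qed

lemma convex_Lp_dual_norm_line:
  assumes \<phi>: "\<phi> \<in> Lp_dual M p" and \<psi>: "\<psi> \<in> Lp_dual M p"
  shows "convex_on UNIV (\<lambda>t. Lp_dual_norm M p (\<phi> + t *\<^sub>R \<psi>))"
proof (rule convex_onI)
  fix u s t :: real assume u: "0 < u" "u < 1"
  let ?\<chi> = "\<lambda>t. \<phi> + t *\<^sub>R \<psi>"
  show "Lp_dual_norm M p (?\<chi> ((1 - u) *\<^sub>R s + u *\<^sub>R t))
      \<le> (1 - u) * Lp_dual_norm M p (?\<chi> s) + u * Lp_dual_norm M p (?\<chi> t)"
  proof (rule Lp_dual_norm_least)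
    fix f :: "'a \<Rightarrow> 'b" assume f: "f \<in> Lp_fun M p" "Lp_norm M p f \<le> 1"
    have "?\<chi> ((1 - u) *\<^sub>R s + u *\<^sub>R t) (Lp_class M p f)
        = (1 - u) * ?\<chi> s (Lp_class M p f) + u * ?\<chi> t (Lp_class M p f)"
      by (simp add: scaleR_fun_def algebra_simps)
    also have "\<bar>\<dots>\<bar> \<le> (1 - u) * \<bar>?\<chi> s (Lp_class M p f)\<bar> + u * \<bar>?\<chi> t (Lp_class M p f)\<bar>"
      using u by (intro order_trans[OF abs_triangle_ineq]) (simp add: abs_mult)
    also have "\<dots> \<le> (1 - u) * Lp_dual_norm M p (?\<chi> s) + u * Lp_dual_norm M p (?\<chi> t)"
      using u by (intro add_mono mult_left_mono Lp_dual_norm_upper Lp_dual_line \<phi> \<psi> f) auto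
    finally show "\<bar>?\<chi> ((1 - u) *\<^sub>R s + u *\<^sub>R t) (Lp_class M p f)\<bar>
        \<le> (1 - u) * Lp_dual_norm M p (?\<chi> s) + u * Lp_dual_norm M p (?\<chi> t)" .
  qed
qed simp

text \<open>
The integrals of the conjugate integrands \<open>V t\<close> equal \<open>F(t)\<^sup>q / q\<close> for \<open>t = 0\<close> and \<open>t = \<plusminus>1/n\<close>, and the
second differences of \<open>V\<close> tend to \<open>0\<close> almost everywhere; dominated convergence and the tangent inequality
for the \<open>q\<close>-th power transfer this to \<open>F\<close>.
\<close>

lemma Lp_dual_norm_second_difference:
  fixes \<phi> \<psi> :: "('w \<Rightarrow> 'a::real_normed_vector) set \<Rightarrow> real"
  assumes fin: "finite_measure M"
    and G: "gateaux_differentiable (UNIV :: ('a \<Rightarrow>\<^sub>L real) set) norm"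
    and p1: "1 < p" and \<phi>: "\<phi> \<in> Lp_dual M p" "\<phi> \<noteq> 0" and \<psi>: "\<psi> \<in> Lp_dual M p"
  defines "F \<equiv> \<lambda>t. Lp_dual_norm M p (\<phi> + t *\<^sub>R \<psi>)"
  shows "(\<lambda>n. (F (1 / real (Suc n)) + F (- (1 / real (Suc n))) - 2 * F 0) * real (Suc n)) \<longlonglongrightarrow> 0"
proof -
  interpret finite_measure M by (rule fin)
  define q where "q = p / (p - 1)"
  have pq: "1 < p" "1 < q" "1 / p + 1 / q = 1" using p1 by (auto simp: q_def field_simps)
  have p: "0 < p" using p1 by simp
  define \<tau> where "\<tau> n = 1 / real (Suc n)" for n
  have \<tau>: "0 < \<tau> n" "\<tau> n \<le> 1" "real (Suc n) * \<tau> n = 1" for n by (simp_all add: \<tau>_def)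
  define T where "T = insert 0 (range \<tau> \<union> range (\<lambda>n. - \<tau> n))"
  have T: "countable T" "0 \<in> T" "\<And>n. \<tau> n \<in> T" "\<And>n. - \<tau> n \<in> T" by (auto simp: T_def)
  have T1: "1 \<in> T" "-1 \<in> T" using T(3,4)[of 0] by (simp_all add: \<tau>_def)
  define L where "L t f = (\<phi> + t *\<^sub>R \<psi>) (Lp_class M p f)" for t f
  have dual: "\<phi> + t *\<^sub>R \<psi> \<in> Lp_dual M p" for t by (rule Lp_dual_line[OF \<phi>(1) \<psi>])
  have L: "Lp_functional M p (F t) (L t)" for t
    unfolding F_def L_def[abs_def] by (rule Lp_dual_functional[OF dual p])
  have F_nonneg: "0 \<le> F t" for t unfolding F_def by (rule Lp_dual_norm_nonneg[OF dual])
  have F0: "0 < F 0" unfolding F_def using Lp_dual_norm_pos[OF \<phi> p] by simp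

  \<comment> \<open>Countably many simple functions determine \<open>F t\<close> for all \<open>t \<in> T\<close>; \<open>D\<close> contains their values.\<close>
  have "\<exists>s. simple_function M s \<and> F t powr q / q - 1 / real (Suc k) < L t s - (\<integral>\<omega>. norm (s \<omega>) powr p \<partial>M) / p"
    for t k
  proof (rule ccontr)
    assume neg: "\<not> ?thesis"
    have "F t powr q / q \<le> F t powr q / q - 1 / real (Suc k)"
      unfolding F_def using neg
      by (intro Lp_dual_norm_conjugate_le[OF fin dual pq]) (auto simp: F_def L_def not_less)
    then show False by simp
  qed
  then obtain S where S: "\<And>t k. simple_function M (S t k)"
    "\<And>t k. F t powr q / q - 1 / real (Suc k) < L t (S t k) - (\<integral>\<omega>. norm (S t k \<omega>) powr p \<partial>M) / p"
    by metis
  have "countable (\<Union>t\<in>T. \<Union>k. S t k ` space M)"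
    using T(1) simple_functionD(1)[OF S(1)] by (intro countable_UN) (auto intro: countable_finite)
  then obtain D where D: "countable D" "(\<Union>t\<in>T. \<Union>k. S t k ` space M) \<subseteq> D" "rational_subspace D"
    using countable_rational_subspace_exists by blast
  have D0: "0 \<in> D" using D(3) by (simp add: rational_subspace_def)
  have S_in_D: "S t k \<omega> \<in> D" if "t \<in> T" "\<omega> \<in> space M" for t k \<omega>
    using D(2) that by blast
  \<comment> \<open>An enumeration of \<open>D\<close> that starts with \<open>0\<close>.\<close>
  define y where "y = case_nat 0 (from_nat_into D)"
  have y: "y 0 = 0" "range y = D"
  proof -
    show "y 0 = 0" by (simp add: y_def)
    have "range (from_nat_into D) = D" using D(1) D0 by (intro range_from_nat_into) auto
    moreover have "range y = insert 0 (range (from_nat_into D))"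
      by (auto simp: y_def image_iff split: nat.splits)
    ultimately show "range y = D" using D0 by auto
  qed

  obtain a where a: "density_family M (L 0) a"
    using density_family_exists[OF L p F_nonneg] by blast
  obtain b where b: "density_family M (\<lambda>f. \<psi> (Lp_class M p f)) b"
    using density_family_exists[OF Lp_dual_functional[OF \<psi> p] p Lp_dual_norm_nonneg[OF \<psi>]] by blast
  have L_line: "L t = (\<lambda>f. L 0 f + t * \<psi> (Lp_class M p f))" for t
    by (simp add: L_def fun_eq_iff scaleR_fun_def)
  have dens: "density_family M (L t) (\<lambda>x \<omega>. a x \<omega> + t * b x \<omega>)" for t
    unfolding L_line[of t] by (rule density_family_line[OF a b])

  have "\<exists>V. integrable M V \<and> (\<integral>\<omega>. V \<omega> \<partial>M) \<le> F t powr q / q \<and> (\<forall>\<omega>. 0 \<le> V \<omega>) \<and>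
      (AE \<omega> in M. \<forall>x\<in>D. a x \<omega> + t * b x \<omega> - norm x powr p / p \<le> V \<omega>) \<and>
      (\<forall>\<omega> c. 0 \<le> c \<longrightarrow> (\<forall>x\<in>D. a x \<omega> + t * b x \<omega> - norm x powr p / p \<le> c) \<longrightarrow> V \<omega> \<le> c)" for t
  proof -
    obtain V where V: "integrable M V" "(\<integral>\<omega>. V \<omega> \<partial>M) \<le> F t powr q / q" "\<And>\<omega>. 0 \<le> V \<omega>"
      "AE \<omega> in M. \<forall>k. a (y k) \<omega> + t * b (y k) \<omega> - norm (y k) powr p / p \<le> V \<omega>"
      "\<And>\<omega> c. 0 \<le> c \<Longrightarrow> (\<And>k. a (y k) \<omega> + t * b (y k) \<omega> - norm (y k) powr p / p \<le> c) \<Longrightarrow> V \<omega> \<le> c"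
      using conjugate_integrand_exists[where y = y, OF dens L pq F_nonneg y(1), of t] by blast
    have least: "V \<omega> \<le> c" if "0 \<le> c" "\<forall>x\<in>D. a x \<omega> + t * b x \<omega> - norm x powr p / p \<le> c" for \<omega> c
      using V(5)[OF that(1)] that(2) y(2) by blast
    have upper: "AE \<omega> in M. \<forall>x\<in>D. a x \<omega> + t * b x \<omega> - norm x powr p / p \<le> V \<omega>"
      using V(4) by eventually_elim (use y(2) in blast)
    show ?thesis by (intro exI[of _ V] conjI allI impI V(1-3) upper least)
  qed
  from choice[OF allI[OF this]]
  obtain V where V: "\<forall>t. integrable M (V t) \<and> (\<integral>\<omega>. V t \<omega> \<partial>M) \<le> F t powr q / q \<and> (\<forall>\<omega>. 0 \<le> V t \<omega>) \<and>
      (AE \<omega> in M. \<forall>x\<in>D. a x \<omega> + t * b x \<omega> - norm x powr p / p \<le> V t \<omega>) \<and>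
      (\<forall>\<omega> c. 0 \<le> c \<longrightarrow> (\<forall>x\<in>D. a x \<omega> + t * b x \<omega> - norm x powr p / p \<le> c) \<longrightarrow> V t \<omega> \<le> c)" ..
  have V_int: "integrable M (V t)" and V_le: "(\<integral>\<omega>. V t \<omega> \<partial>M) \<le> F t powr q / q"
    and V_nonneg: "0 \<le> V t \<omega>"
    and V_upper: "AE \<omega> in M. \<forall>x\<in>D. a x \<omega> + t * b x \<omega> - norm x powr p / p \<le> V t \<omega>" for t \<omega>
    using V by auto
  have V_least: "V t \<omega> \<le> c"
    if "0 \<le> c" "\<forall>x\<in>D. a x \<omega> + t * b x \<omega> - norm x powr p / p \<le> c" for t \<omega> c
    using V that by blast
  have F_le: "F t powr q / q \<le> (\<integral>\<omega>. V t \<omega> \<partial>M)" if t: "t \<in> T" for t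
  proof -
    have "F t powr q / q - 1 / real (Suc k) \<le> (\<integral>\<omega>. V t \<omega> \<partial>M)" for k
    proof -
      have "L t (S t k) - (\<integral>\<omega>. norm (S t k \<omega>) powr p \<partial>M) / p \<le> (\<integral>\<omega>. V t \<omega> \<partial>M)"
        by (rule simple_function_conjugate_le[OF dens L p S(1) _ V_int V_upper]) (rule S_in_D[OF t])
      then show ?thesis using S(2)[of t k] by linarith
    qed
    moreover have "(\<lambda>k. F t powr q / q - 1 / real (Suc k)) \<longlonglongrightarrow> F t powr q / q - 0"
      by (intro tendsto_diff tendsto_const) (use LIMSEQ_inverse_real_of_nat in \<open>simp add: inverse_eq_divide\<close>)
    ultimately show ?thesis by (intro LIMSEQ_le_const2) auto
  qed

  have "AE \<omega> in M. \<forall>t\<in>T. \<forall>x\<in>D. a x \<omega> + t * b x \<omega> - norm x powr p / p \<le> V t \<omega>"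
    by (rule AE_ball_countable'[OF V_upper T(1)])
  moreover have "AE \<omega> in M. \<forall>x\<in>D. \<forall>z\<in>D. a (x + z) \<omega> = a x \<omega> + a z \<omega>"
    by (intro AE_ball_countable' D(1) density_family_add[OF a L])
  moreover have "AE \<omega> in M. \<forall>x\<in>D. \<forall>z\<in>D. b (x + z) \<omega> = b x \<omega> + b z \<omega>"
    by (intro AE_ball_countable' D(1) density_family_add[OF b Lp_dual_functional[OF \<psi> p]])
  moreover have "AE \<omega> in M. \<forall>r\<in>\<rat>. \<forall>x\<in>D. a (r *\<^sub>R x) \<omega> = r * a x \<omega>"
    by (intro AE_ball_countable' D(1) countable_rat density_family_scale[OF a L])
  moreover have "AE \<omega> in M. \<forall>r\<in>\<rat>. \<forall>x\<in>D. b (r *\<^sub>R x) \<omega> = r * b x \<omega>"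
    by (intro AE_ball_countable' D(1) countable_rat density_family_scale[OF b Lp_dual_functional[OF \<psi> p]])
  ultimately have good: "AE \<omega> in M.
      (\<forall>n. 2 * V 0 \<omega> \<le> V (\<tau> n) \<omega> + V (- \<tau> n) \<omega>) \<and>
      (\<forall>n. V (\<tau> n) \<omega> + V (- \<tau> n) \<omega> - 2 * V 0 \<omega> \<le> \<tau> n * (V 1 \<omega> + V (-1) \<omega> - 2 * V 0 \<omega>)) \<and>
      (\<lambda>n. (V (\<tau> n) \<omega> + V (- \<tau> n) \<omega> - 2 * V 0 \<omega>) * real (Suc n)) \<longlonglongrightarrow> 0"
  proof eventually_elim
    case (elim \<omega>)
    have upper: "a x \<omega> + t * b x \<omega> - norm x powr p / p \<le> V t \<omega>" if "t \<in> T" "x \<in> D" for t x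
      using elim(1) that by blast
    have lower: "2 * V 0 \<omega> \<le> V (\<tau> n) \<omega> + V (- \<tau> n) \<omega>" for n
    proof -
      have "V 0 \<omega> \<le> (V (\<tau> n) \<omega> + V (- \<tau> n) \<omega>) / 2"
      proof (rule V_least)
        show "0 \<le> (V (\<tau> n) \<omega> + V (- \<tau> n) \<omega>) / 2"
          using V_nonneg[of "\<tau> n" \<omega>] V_nonneg[of "- \<tau> n" \<omega>] by simp
        show "\<forall>x\<in>D. a x \<omega> + 0 * b x \<omega> - norm x powr p / p \<le> (V (\<tau> n) \<omega> + V (- \<tau> n) \<omega>) / 2"
        proof
          fix x assume x: "x \<in> D"
          show "a x \<omega> + 0 * b x \<omega> - norm x powr p / p \<le> (V (\<tau> n) \<omega> + V (- \<tau> n) \<omega>) / 2"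
            using upper[OF T(3) x, of n] upper[OF T(4) x, of n] by (simp add: field_simps)
        qed
      qed
      then show ?thesis by simp
    qed
    \<comment> \<open>Convexity of \<open>t \<mapsto> V t \<omega>\<close> between \<open>0\<close> and \<open>s\<close>; the cases \<open>s = \<plusminus>1\<close> give the dominating function.\<close>
    have interpolate: "V (s * \<tau> n) \<omega> \<le> (1 - \<tau> n) * V 0 \<omega> + \<tau> n * V s \<omega>" if s: "s \<in> T" for s n
    proof (rule V_least)
      show "0 \<le> (1 - \<tau> n) * V 0 \<omega> + \<tau> n * V s \<omega>"
        using V_nonneg[of 0 \<omega>] V_nonneg[of s \<omega>] \<tau>[of n] by (intro add_nonneg_nonneg mult_nonneg_nonneg) auto
      show "\<forall>x\<in>D. a x \<omega> + s * \<tau> n * b x \<omega> - norm x powr p / p \<le> (1 - \<tau> n) * V 0 \<omega> + \<tau> n * V s \<omega>"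
      proof
        fix x assume x: "x \<in> D"
        have eq: "(1 - \<tau> n) * (u - c) + \<tau> n * (u + s * v - c) = u + s * \<tau> n * v - c" for u v c
          by (simp add: algebra_simps)
        have "(1 - \<tau> n) * (a x \<omega> - norm x powr p / p) + \<tau> n * (a x \<omega> + s * b x \<omega> - norm x powr p / p)
            \<le> (1 - \<tau> n) * V 0 \<omega> + \<tau> n * V s \<omega>"
          using upper[OF T(2) x] upper[OF s x] \<tau>[of n] by (intro add_mono mult_left_mono) auto
        then show "a x \<omega> + s * \<tau> n * b x \<omega> - norm x powr p / p \<le> (1 - \<tau> n) * V 0 \<omega> + \<tau> n * V s \<omega>"
          unfolding eq .
      qed
    qed
    have "V (\<tau> n) \<omega> + V (- \<tau> n) \<omega> - 2 * V 0 \<omega> \<le> \<tau> n * (V 1 \<omega> + V (-1) \<omega> - 2 * V 0 \<omega>)" for n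
      using interpolate[OF T1(1), of n] interpolate[OF T1(2), of n] by (simp add: algebra_simps)
    moreover have "(\<lambda>n. (V (\<tau> n) \<omega> + V (- \<tau> n) \<omega> - 2 * V 0 \<omega>) * real (Suc n)) \<longlonglongrightarrow> 0"
      unfolding \<tau>_def
    proof (rule conjugate_second_difference[where a = "\<lambda>x. a x \<omega>" and b = "\<lambda>x. b x \<omega>" and V = "\<lambda>t. V t \<omega>",
          OF G pq D(3)])
      show "rational_linear_on D (\<lambda>x. a x \<omega>)" "rational_linear_on D (\<lambda>x. b x \<omega>)"
        using elim(2-5) by (auto simp: rational_linear_on_def)
      show "a x \<omega> - norm x powr p / p \<le> V 0 \<omega>" if "x \<in> D" for x
        using upper[OF T(2) that] by simp
      show "a x \<omega> + b x \<omega> - norm x powr p / p \<le> V 1 \<omega>" if "x \<in> D" for x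
        using upper[OF T1(1) that] by simp
      show "V t \<omega> \<le> c" if "0 \<le> c" "\<And>x. x \<in> D \<Longrightarrow> a x \<omega> + t * b x \<omega> - norm x powr p / p \<le> c" for t c
        using that by (intro V_least) auto
      show "2 * V 0 \<omega> \<le> V (1 / real (Suc n)) \<omega> + V (- (1 / real (Suc n))) \<omega>" for n
        using lower[of n] by (simp add: \<tau>_def)
    qed (rule V_nonneg)
    ultimately show ?case using lower by blast
  qed

  define W where "W n \<omega> = (V (\<tau> n) \<omega> + V (- \<tau> n) \<omega> - 2 * V 0 \<omega>) * real (Suc n)" for n \<omega>
  have "(\<lambda>n. \<integral>\<omega>. W n \<omega> \<partial>M) \<longlonglongrightarrow> (\<integral>\<omega>. 0 \<partial>M)"
  proof (rule integral_dominated_convergence[where w = "\<lambda>\<omega>. V 1 \<omega> + V (-1) \<omega> - 2 * V 0 \<omega>"])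
    show "integrable M (\<lambda>\<omega>. V 1 \<omega> + V (-1) \<omega> - 2 * V 0 \<omega>)" using V_int by simp
    show "AE \<omega> in M. (\<lambda>n. W n \<omega>) \<longlonglongrightarrow> 0"
      using good by eventually_elim (simp only: W_def)
    show "W n \<in> borel_measurable M" for n
      unfolding W_def using V_int by (intro borel_measurable_integrable) simp
    show "AE \<omega> in M. norm (W n \<omega>) \<le> V 1 \<omega> + V (-1) \<omega> - 2 * V 0 \<omega>" for n
      using good
    proof eventually_elim
      case (elim \<omega>)
      have "W n \<omega> \<le> \<tau> n * (V 1 \<omega> + V (-1) \<omega> - 2 * V 0 \<omega>) * real (Suc n)"
        unfolding W_def using elim by (intro mult_right_mono) auto
      also have "\<dots> = V 1 \<omega> + V (-1) \<omega> - 2 * V 0 \<omega>"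
        using \<tau>(3)[of n] by (metis mult.assoc mult.commute mult.left_neutral)
      finally have "W n \<omega> \<le> V 1 \<omega> + V (-1) \<omega> - 2 * V 0 \<omega>" .
      moreover have "0 \<le> W n \<omega>"
        unfolding W_def using elim by (intro mult_nonneg_nonneg) auto
      ultimately show ?case by simp
    qed
  qed simp
  then have W_lim: "(\<lambda>n. (\<integral>\<omega>. W n \<omega> \<partial>M) / F 0 powr (q - 1)) \<longlonglongrightarrow> 0"
    using tendsto_divide[OF _ tendsto_const, of _ 0 _ "F 0 powr (q - 1)"] F0 by simp
  have convex: "convex_on UNIV F" unfolding F_def by (rule convex_Lp_dual_norm_line[OF \<phi>(1) \<psi>])
  have F_lower: "0 \<le> F (\<tau> n) + F (- \<tau> n) - 2 * F 0" for n
    using convex_onD[OF convex, of "1 / 2" "\<tau> n" "- \<tau> n"] by (simp add: field_simps)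
  have F_upper: "(F (\<tau> n) + F (- \<tau> n) - 2 * F 0) * real (Suc n) \<le> (\<integral>\<omega>. W n \<omega> \<partial>M) / F 0 powr (q - 1)" for n
  proof -
    have "F 0 powr (q - 1) * (F t - F 0) \<le> (F t powr q - F 0 powr q) / q" for t
      using powr_above_tangent[OF pq(2) F_nonneg F0, of t] pq by (simp add: field_simps)
    from add_mono[OF this[of "\<tau> n"] this[of "- \<tau> n"]]
    have "F 0 powr (q - 1) * (F (\<tau> n) + F (- \<tau> n) - 2 * F 0)
        \<le> F (\<tau> n) powr q / q + F (- \<tau> n) powr q / q - 2 * (F 0 powr q / q)"
      by (simp add: algebra_simps diff_divide_distrib)
    also have "\<dots> \<le> (\<integral>\<omega>. V (\<tau> n) \<omega> \<partial>M) + (\<integral>\<omega>. V (- \<tau> n) \<omega> \<partial>M) - 2 * (\<integral>\<omega>. V 0 \<omega> \<partial>M)"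
      using F_le[OF T(3), of n] F_le[OF T(4), of n] V_le[of 0] by linarith
    also have "\<dots> = (\<integral>\<omega>. V (\<tau> n) \<omega> + V (- \<tau> n) \<omega> - 2 * V 0 \<omega> \<partial>M)"
      using V_int by simp
    finally have "F 0 powr (q - 1) * (F (\<tau> n) + F (- \<tau> n) - 2 * F 0) * real (Suc n) \<le> (\<integral>\<omega>. W n \<omega> \<partial>M)"
      unfolding W_def by (subst integral_mult_left_zero) (intro mult_right_mono, auto)
    then show ?thesis using F0 by (simp add: field_simps)
  qed
  show ?thesis
    unfolding \<tau>_def[symmetric]
    using F_lower F_upper
    by (intro tendsto_sandwich[OF _ _ tendsto_const W_lim] always_eventually allI) auto
qed

theorem theorem1p8:
  fixes M :: "'w measure" and p :: real
  assumes "prob_space M"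
    and "gateaux_differentiable (UNIV :: ('a::banach \<Rightarrow>\<^sub>L real) set) norm"
    and "1 < p"
  shows "gateaux_differentiable
    (Lp_dual M p :: (('w \<Rightarrow> 'a) set \<Rightarrow> real) set) (Lp_dual_norm M p)"
  unfolding gateaux_differentiable_def
proof (intro ballI impI)
  interpret prob_space M by fact
  fix \<phi> \<psi> :: "('w \<Rightarrow> 'a) set \<Rightarrow> real"
  assume \<phi>: "\<phi> \<in> Lp_dual M p" "\<phi> \<noteq> 0" and \<psi>: "\<psi> \<in> Lp_dual M p"
  show "\<exists>l. ((\<lambda>t. (Lp_dual_norm M p (\<phi> + t *\<^sub>R \<psi>) - Lp_dual_norm M p \<phi>) / t) \<longlongrightarrow> l) (at 0)"
    using convex_differentiable_at_0[OF convex_Lp_dual_norm_line[OF \<phi>(1) \<psi>]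
        Lp_dual_norm_second_difference[OF finite_measure_axioms assms(2,3) \<phi> \<psi>]]
    by (simp only: scaleR_zero_left add_0_right)
qed

end
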